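(* Let $m,d \ge 1$ be integers. Let $F := (F_i)_{i=1,\ldots,d} : \mathbb{R}_+ \times \mathbb{R}^m \to \mathbb{R}^d$ be such that $F_i \in \Gamma_0(\cdot,\mathbb{R}^m)$ for every $i=1,\ldots,d$. Assume that $C(t) := \{x \in \mathbb{R}^m \mid F(t,x) \in \mathbb{R}^d_-\}$ is not empty for all $t \ge 0$. Let $g : \mathbb{R}_+ \times \mathbb{R}^m \to \mathbb{R}$ be such that $g(t,\cdot)$ is differentiable on $\mathbb{R}^m$ with $\nabla_x g(t,\cdot) \in \mathcal{A}(\mathbb{R}^m)$ for all $t \ge 0$. Then, for all $t \ge 0$, the parameterized convex minimization problem with inequality constraints $$\operatorname*{argmin}_{x \in \mathbb{R}^m,\ F(t,x) \in \mathbb{R}^d_-} g(t,x)$$ admits a unique solution, denoted by $y(t)$. If moreover the following assumptions are satisfied: (i) $\nabla_x g \in \mathcal{A}_{\mathrm{unif}}(\cdot,\mathbb{R}^m)$; (ii) $\nabla_x g$ is of class $C^1$ on $\mathbb{R}_+ \times \mathbb{R}^m$; (iii) $F$ is of class $C^2$ on $\mathbb{R}_+ \times \mathbb{R}^m$; (iv) $\nabla_t F(0,y(0)) = 0_{\mathbb{R}^d}$; (v) $y(0) \in C(t)$ for all $t \ge 0$; (vi) there is some $\alpha > 0$ such that $\|\nabla_x F(t,y(0))^\top w\|_{\mathbb{R}^m} \ge \alpha$ for all $w \in \mathrm{N}(F(t,y(0)))$ with $\|w\|_{\mathbb{R}^d} = 1$ and all $t \ge 0$; then $y : \mathbb{R}_+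 \to \mathbb{R}^m$ is differentiable at $t=0$ and $y'(0)$ is the unique solution of the convex minimization problem with linear inequality/equality constraints $$\operatorname*{argmin}_{x \in \mathrm{K}(y(0)|v_0)} \Big[ \tfrac12 \langle \nabla^2_{xx} g(0,y(0))(x), x\rangle + \langle \nabla^2_{tx} g(0,y(0)), x\rangle + \sigma_{\mathrm{Y}(y(0)|v_0)}\Big( \tfrac12 D^2F(0,y(0))(1,x)\Big) \Big],$$ where $v_0 := -\nabla_x g(0,y(0))$.
   Context: $\mathbb{R}_+=[0,+\infty)$, $\mathbb{R}_-=(-\infty,0]$, $\mathbb{R}^d_-=\mathbb{R}_-\times\cdots\times\mathbb{R}_-$; $\langle\cdot,\cdot\rangle$ and $\|\cdot\|$ are the Euclidean scalar product and norm. Differentiability at $t=0$ of functions defined on $\mathbb{R}_+$ is from the right. $\Gamma_0(\cdot,\mathbb{R}^m)$ is the set of functions $h:\mathbb{R}_+\times\mathbb{R}^m\to\mathbb{R}\cup\{+\infty\}$ such that $h(t,\cdot)$ is proper, lower semi-continuous and convex for all $t\ge0$. $\mathcal{A}(\mathbb{R}^m)$ is the set of maps $A:\mathbb{R}^m\to\mathbb{R}^m$ that are Lipschitz continuous and strongly monotone ($\exists\alpha>0$: $\langle A(x_2)-A(x_1),x_2-x_1\rangle\ge\alpha\|x_2-x_1\|^2$ for all $x_1,x_2$). $\mathcal{A}_{\mathrm{unif}}(\cdot,\mathbb{R}^m)$ is the set of $A:\mathbb{R}_+\times\mathbb{R}^m\to\mathbb{R}^m$ such that $A(t,\cdot)$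 is Lipschitz continuous and strongly monotone for all $t\ge0$ with Lipschitz constant and strong monotonicity constant independent of $t$. $\nabla_xg(t,x)$ is the gradient of $g(t,\cdot)$ at $x$; $\nabla^2_{xx}g$ and $\nabla^2_{tx}g$ are the partial derivatives of $\nabla_xg$ with respect to $x$ and $t$. $\nabla_tF(t,x)\in\mathbb{R}^d$ is the partial derivative of $F$ in $t$, $\nabla_xF(t,x)$ is the $d\times m$ Jacobian matrix of $F(t,\cdot)$ at $x$. $D^2F(t,x)$ is the second-order Fréchet differential of $F$ at $(t,x)$, and $D^2F(0,y)(1,x)\in\mathbb{R}^d$ denotes the associated quadratic map evaluated at the direction $(1,x)\in\mathbb{R}\times\mathbb{R}^m$, i.e. its $i$-th component is $D^2F_i(0,y)[(1,x),(1,x)]$. For $w\in\mathbb{R}^d_-$, $\mathrm{N}(w)$ and $\mathrm{T}(w)$ denote the normal cone and the tangent cone (of convex analysis) to $\mathbb{R}^d_-$ at $w$. For $(y,v)\in\mathbb{R}^m\times\mathbb{R}^m$ with $F(0,y)\in\mathbb{R}^d_-$, $$\mathrm{K}(y|v):=\{x\in\mathbb{R}^m\mid\nabla_xF(0,y)x\in\mathrm{T}(F(0,y))\text{ and }\langle x,v\rangle=0\},$$ $$\mathrm{Y}(y|v):=\{w\in\mathbb{R}^d\mid w\in\mathrm{N}(F(0,y))\text{ and }\nabla_xF(0,y)^\top w=v\}.$$ $\sigma_{\mathrm{Y}}(u):=\sup_{w\in\mathrm{Y}}\langle w,u\rangle$ is the support function of a nonempty closed convex set $\mathrm{Y}\subset\mathbb{R}^d$.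 *)

theory Defs
  imports "HOL-Analysis.Analysis"
begin

text \<open>
  Functions on \<open>\<real>\<^sub>+ \<times> \<real>\<^sup>m\<close> are modelled by total curried functions of type
  \<open>real \<Rightarrow> real ^ 'm \<Rightarrow> _\<close>; hypotheses only concern times \<open>t \<ge> 0\<close>, and derivatives
  involving the time variable are taken within \<open>{0..}\<close>, i.e. from the right at \<open>0\<close>.
\<close>

definition proper_fun :: "('a \<Rightarrow> ereal) \<Rightarrow> bool" where
  "proper_fun f \<longleftrightarrow> (\<forall>x. f x \<noteq> -\<infinity>) \<and> (\<exists>x. f x \<noteq> \<infinity>)"

definition lsc_fun :: "('a::topological_space \<Rightarrow> ereal) \<Rightarrow> bool" where
  "lsc_fun f \<longleftrightarrow> (\<forall>x. f x \<le> Liminf (at x) f)"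

text \<open>Only used for functions without the value \<open>-\<infinity>\<close>; recall \<open>0 * \<infinity> = 0\<close> on \<open>ereal\<close>.\<close>

definition convex_fun :: "('a::real_vector \<Rightarrow> ereal) \<Rightarrow> bool" where
  "convex_fun f \<longleftrightarrow>
     (\<forall>x y. \<forall>u\<ge>0. \<forall>v\<ge>0. u + v = (1::real) \<longrightarrow>
        f (u *\<^sub>R x + v *\<^sub>R y) \<le> ereal u * f x + ereal v * f y)"

definition Gamma0 :: "(real \<Rightarrow> real ^ 'm \<Rightarrow> ereal) set" where
  "Gamma0 = {h. \<forall>t\<ge>0. proper_fun (h t) \<and> lsc_fun (h t) \<and> convex_fun (h t)}"

definition strongly_monotone_with :: "real \<Rightarrow> ('a::real_inner \<Rightarrow> 'a) \<Rightarrow> bool" where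
  "strongly_monotone_with \<alpha> A \<longleftrightarrow>
     (\<forall>x1 x2. inner (A x2 - A x1) (x2 - x1) \<ge> \<alpha> * (norm (x2 - x1))\<^sup>2)"

definition A_maps :: "(real ^ 'm \<Rightarrow> real ^ 'm) set" where
  "A_maps = {A. (\<exists>L. L-lipschitz_on UNIV A) \<and> (\<exists>\<alpha>>0. strongly_monotone_with \<alpha> A)}"

definition A_unif :: "(real \<Rightarrow> real ^ 'm \<Rightarrow> real ^ 'm) set" where
  "A_unif = {A. \<exists>L. \<exists>\<alpha>>0. \<forall>t\<ge>0. L-lipschitz_on UNIV (A t) \<and> strongly_monotone_with \<alpha> (A t)}"

definition grad :: "('a::real_inner \<Rightarrow> real) \<Rightarrow> 'a \<Rightarrow> 'a" where
  "grad f x = (THE D. GDERIV f x :> D)"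

text \<open>
  Frechet derivative relative to \<open>S\<close>, as an element of the normed space of bounded linear maps.
  It is uniquely determined for \<open>S = {0..} \<times> UNIV\<close>, a convex set with nonempty interior.
\<close>

definition Fderiv ::
  "'a::real_normed_vector set \<Rightarrow> ('a \<Rightarrow> 'b::real_normed_vector) \<Rightarrow> 'a \<Rightarrow> ('a \<Rightarrow>\<^sub>L 'b)" where
  "Fderiv S f z = Blinfun (frechet_derivative f (at z within S))"

definition C1_on :: "'a::real_normed_vector set \<Rightarrow> ('a \<Rightarrow> 'b::real_normed_vector) \<Rightarrow> bool" where
  "C1_on S f \<longleftrightarrow> f differentiable_on S \<and> continuous_on S (Fderiv S f)"

definition C2_on :: "'a::real_normed_vector set \<Rightarrow> ('a \<Rightarrow> 'b::real_normed_vector) \<Rightarrow> bool" where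
  "C2_on S f \<longleftrightarrow> C1_on S f \<and> C1_on S (Fderiv S f)"

text \<open>The quadratic map \<open>h \<mapsto> D\<^sup>2 f(z)[h, h]\<close>.\<close>

definition D2_quad ::
  "'a::real_normed_vector set \<Rightarrow> ('a \<Rightarrow> 'b::real_normed_vector) \<Rightarrow> 'a \<Rightarrow> 'a \<Rightarrow> 'b" where
  "D2_quad S f z h = blinfun_apply (blinfun_apply (Fderiv S (Fderiv S f) z) h) h"

abbreviation half_space :: "(real \<times> (real ^ 'm)) set" where
  "half_space \<equiv> {0..} \<times> UNIV"

definition nonpos_orthant :: "(real ^ 'd) set" where
  "nonpos_orthant = {w. \<forall>i. w $ i \<le> 0}"

text \<open>Both cones are only used at points \<open>w \<in> S\<close>, for \<open>S\<close> convex.\<close>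

definition normal_cone :: "'a::real_inner set \<Rightarrow> 'a \<Rightarrow> 'a set" where
  "normal_cone S w = {z. \<forall>u\<in>S. inner z (u - w) \<le> 0}"

definition tangent_cone :: "'a::real_normed_vector set \<Rightarrow> 'a \<Rightarrow> 'a set" where
  "tangent_cone S w = closure (cone hull ((\<lambda>u. u - w) ` S))"

text \<open>
  \<open>jacobian (F t) (at x)\<close> is the matrix of \<open>\<nabla>\<^sub>xF(t,x)\<close>.
\<close>

definition K_set :: "(real \<Rightarrow> real ^ 'm \<Rightarrow> real ^ 'd) \<Rightarrow> real ^ 'm \<Rightarrow> real ^ 'm \<Rightarrow> (real ^ 'm) set" where
  "K_set F y v =
     {x. jacobian (F 0) (at y) *v x \<in> tangent_cone nonpos_orthant (F 0 y) \<and> inner x v = 0}"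

definition Y_set :: "(real \<Rightarrow> real ^ 'm \<Rightarrow> real ^ 'd) \<Rightarrow> real ^ 'm \<Rightarrow> real ^ 'm \<Rightarrow> (real ^ 'd) set" where
  "Y_set F y v =
     {w. w \<in> normal_cone nonpos_orthant (F 0 y) \<and> transpose (jacobian (F 0) (at y)) *v w = v}"

definition support_fun :: "'a::real_inner set \<Rightarrow> 'a \<Rightarrow> ereal" where
  "support_fun Y u = (SUP w\<in>Y. ereal (inner w u))"

definition is_unique_arg_min :: "('a \<Rightarrow> 'b::linorder) \<Rightarrow> 'a set \<Rightarrow> 'a \<Rightarrow> bool" where
  "is_unique_arg_min f S x \<longleftrightarrow>
     is_arg_min f (\<lambda>z. z \<in> S) x \<and> (\<forall>x'. is_arg_min f (\<lambda>z. z \<in> S) x' \<longrightarrow> x' = x)"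

definition feasible_set :: "(real \<Rightarrow> real ^ 'm \<Rightarrow> real ^ 'd) \<Rightarrow> real \<Rightarrow> (real ^ 'm) set" where
  "feasible_set F t = {x. F t x \<in> nonpos_orthant}"

text \<open>
  Objective of the limit problem at the point \<open>y\<close> with \<open>v = -\<nabla>\<^sub>xg(0,y)\<close>:
  the second derivatives \<open>\<nabla>\<^sup>2\<^sub>x\<^sub>xg\<close> and \<open>\<nabla>\<^sup>2\<^sub>t\<^sub>xg\<close> are the partial derivatives of
  \<open>(t, x) \<mapsto> \<nabla>\<^sub>xg(t,x)\<close>.
\<close>

definition limit_objective ::
  "(real \<Rightarrow> real ^ 'm \<Rightarrow> real ^ 'd) \<Rightarrow> (real \<Rightarrow> real ^ 'm \<Rightarrow> real) \<Rightarrow> real ^ 'm \<Rightarrow> real ^ 'm \<Rightarrow>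
   real ^ 'm \<Rightarrow> ereal" where
  "limit_objective F g y v x =
     ereal (1 / 2 * inner (frechet_derivative (grad (g 0)) (at y) x) x
       + inner (vector_derivative (\<lambda>t. grad (g t) y) (at 0 within {0..})) x)
     + support_fun (Y_set F y v)
         ((1 / 2) *\<^sub>R D2_quad half_space (\<lambda>(t, z). F t z) (0, y) (1, x))"

end

theory Submission
  imports Defs
begin

text \<open>
  Strong convexity of \<open>g t\<close>, a multiplier at \<open>t = 0\<close> and convexity of \<open>F t\<close> bound the difference
  quotients \<open>x\<^sub>t = (y t - y 0) / t\<close>, so it suffices that each of their cluster points minimises the
  limit objective, the minimiser being unique by strict convexity. After subtracting \<open>g t (y 0)\<close> and
  dividing by \<open>t\<^sup>2\<close>, the objective at \<open>y 0 + t x\<close> is the quadratic part of the limit objective plus the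
  singular term \<open>- \<langle>v, x\<rangle> / t\<close>. Testing the constraint \<open>F t (y t) \<le> 0\<close> against the multipliers
  \<open>w \<in> Y\<close> and expanding to second order bounds the singular term at \<open>x\<^sub>t\<close> from below by the support
  function in the limit. Conversely, linear programming duality yields for each \<open>x \<in> K\<close> a direction
  \<open>\<xi>\<close> such that the arc \<open>y 0 + t x + t\<^sup>2 \<xi>\<close> is feasible and attains this bound up to an
  arbitrarily small error.
\<close>

section \<open>Scaling and limit estimates\<close>

text \<open>Lets a one-sided bound along all positive multiples fix a sign, which is how the
  separation argument below exploits cones and affine maps.\<close>

lemma nonpos_if_multiples_bounded:
  fixes x y :: real
  assumes "\<And>N. N > 0 \<Longrightarrow> N * x \<le> y"
  shows "x \<le> 0"
proof (rule ccontr)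
  assume "\<not> x \<le> 0"
  then have "((\<bar>y\<bar> + 1) / x) * x \<le> y" by (intro assms) auto
  with \<open>\<not> x \<le> 0\<close> show False by auto
qed

text \<open>Frechet remainder estimates arrive as an arbitrary e times a fixed factor; the factor
  may have any sign, so e is rescaled by \<open>\<bar>M\<bar> + 1\<close>.\<close>

lemma tendsto_zero_if_norm_le_scaled:
  fixes X :: "'a \<Rightarrow> 'b::real_normed_vector" and M :: real
  assumes "\<And>e. e > 0 \<Longrightarrow> eventually (\<lambda>n. norm (X n) \<le> e * M) F"
  shows "(X \<longlongrightarrow> 0) F"
proof (rule tendstoI)
  fix e :: real assume "e > 0"
  have pos: "\<bar>M\<bar> + 1 > 0" by linarith
  have "e / (\<bar>M\<bar> + 1) * M \<le> e / (\<bar>M\<bar> + 1) * \<bar>M\<bar>"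
    using \<open>e > 0\<close> pos by (intro mult_left_mono) auto
  also have "\<dots> < e" using \<open>e > 0\<close> pos by (simp add: field_simps)
  finally have "e / (\<bar>M\<bar> + 1) * M < e" .
  moreover have "eventually (\<lambda>n. norm (X n) \<le> e / (\<bar>M\<bar> + 1) * M) F"
    using \<open>e > 0\<close> pos by (intro assms) auto
  ultimately show "eventually (\<lambda>n. dist (X n) 0 < e) F"
    by (auto elim!: eventually_mono)
qed

lemma LIMSEQ_norm_bounded:
  assumes "X \<longlonglongrightarrow> x"
  obtains B where "B > 0" "\<And>n. norm (X n) \<le> B"
  using convergent_imp_Bseq[OF convergentI[OF assms]] by (auto elim!: BseqE)

section \<open>Second-order expansions along sequences\<close>

text \<open>The mean value inequality is applied to the difference with the quadratic model. The
  hypothesis bears on the first derivative, which in the uses is nearly affine along a short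
  segment, while a second derivative is given only at the base point.\<close>

lemma second_order_mean_value:
  fixes \<phi> :: "real \<Rightarrow> 'b::real_normed_vector"
  assumes der: "\<And>s. s \<in> {0..1} \<Longrightarrow> (\<phi> has_vector_derivative \<phi>' s) (at s within {0..1})"
    and bd: "\<And>s. s \<in> {0..1} \<Longrightarrow> norm (\<phi>' s - a - s *\<^sub>R c) \<le> e"
  shows "norm (\<phi> 1 - \<phi> 0 - a - (1/2) *\<^sub>R c) \<le> e"
proof -
  define \<psi> where "\<psi> = (\<lambda>s. \<phi> s - s *\<^sub>R a - (s\<^sup>2 / 2) *\<^sub>R c)"
  have d: "(\<psi> has_derivative (\<lambda>h. h *\<^sub>R (\<phi>' s - a - s *\<^sub>R c))) (at s within {0..1})"
    if "s \<in> {0..1}" for s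
  proof -
    have "(\<psi> has_vector_derivative (\<phi>' s - a - s *\<^sub>R c)) (at s within {0..1})"
      unfolding \<psi>_def
      by (rule derivative_eq_intros der[OF that] refl | simp)+
    then show ?thesis by (simp add: has_vector_derivative_def)
  qed
  have "norm (\<psi> 1 - \<psi> 0) \<le> e * norm (1 - 0 :: real)"
  proof (rule differentiable_bound[OF _ d])
    fix s :: real assume s: "s \<in> {0..1}"
    show "onorm (\<lambda>h. h *\<^sub>R (\<phi>' s - a - s *\<^sub>R c)) \<le> e"
    proof (rule onorm_le)
      fix h :: real
      show "norm (h *\<^sub>R (\<phi>' s - a - s *\<^sub>R c)) \<le> e * norm h"
        using mult_right_mono[OF bd[OF s], of "\<bar>h\<bar>"] by (simp add: mult.commute)
    qed
  qed auto
  then show ?thesis by (simp add: \<psi>_def algebra_simps)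
qed

text \<open>Convexity keeps the segment inside \<open>S\<close>, so the chain rule applies to
  derivatives relative to \<open>S\<close>, as the one-sided time variable demands.\<close>

lemma has_vector_derivative_along_segment:
  fixes f :: "'a::real_normed_vector \<Rightarrow> 'b::real_normed_vector"
  assumes "convex S" "z \<in> S" "z + k \<in> S" "s \<in> {0..1}"
    and "(f has_derivative f') (at (z + s *\<^sub>R k) within S)"
  shows "((\<lambda>s. f (z + s *\<^sub>R k)) has_vector_derivative f' k) (at s within {0..1})"
proof -
  have sub: "(\<lambda>s. z + s *\<^sub>R k) ` {0..1} \<subseteq> S"
  proof safe
    fix r :: real assume "r \<in> {0..1}"
    then have "(1 - r) *\<^sub>R z + r *\<^sub>R (z + k) \<in> S"
      using assms by (intro convexD) auto
    then show "z + r *\<^sub>R k \<in> S" by (simp add: algebra_simps)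
  qed
  have "((\<lambda>s. z + s *\<^sub>R k) has_derivative (\<lambda>h. h *\<^sub>R k)) (at s within {0..1})"
    by (rule derivative_eq_intros refl | simp)+
  from has_derivative_in_compose[OF this has_derivative_subset[OF assms(5) sub]]
  show ?thesis
    using has_derivative_linear[OF assms(5)]
    by (simp add: has_vector_derivative_def linear_scale)
qed

text \<open>The directions \<open>k n\<close> vary, and the linear term is evaluated at
  \<open>k n\<close> rather than at \<open>k0\<close>: the discrepancy \<open>k n - k0\<close> need
  not be of the order of \<open>t n\<close>.\<close>

lemma second_order_expansion:
  fixes f :: "'a::real_normed_vector \<Rightarrow> 'b::real_normed_vector"
    and f' :: "'a \<Rightarrow> 'a \<Rightarrow>\<^sub>L 'b" and f'' :: "'a \<Rightarrow>\<^sub>L 'a \<Rightarrow>\<^sub>L 'b"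
  assumes S: "convex S" "z \<in> S"
    and der: "\<And>x. x \<in> S \<Longrightarrow> (f has_derivative f' x) (at x within S)"
    and der2: "(f' has_derivative f'') (at z within S)"
    and t: "t \<longlonglongrightarrow> 0" "\<And>n. t n > 0"
    and k: "k \<longlonglongrightarrow> k0" "\<And>n. z + t n *\<^sub>R k n \<in> S"
  shows "(\<lambda>n. (1 / (t n)\<^sup>2) *\<^sub>R (f (z + t n *\<^sub>R k n) - f z - t n *\<^sub>R f' z (k n)))
    \<longlonglongrightarrow> (1/2) *\<^sub>R f'' k0 k0"
proof -
  define X where "X = (\<lambda>n. (1 / (t n)\<^sup>2) *\<^sub>R (f (z + t n *\<^sub>R k n) - f z - t n *\<^sub>R f' z (k n))
    - (1/2) *\<^sub>R f'' (k n) (k n))"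
  obtain M where M: "M > 0" "\<And>n. norm (k n) \<le> M"
    by (rule LIMSEQ_norm_bounded[OF k(1)]) blast
  have "X \<longlonglongrightarrow> 0"
  proof (rule tendsto_zero_if_norm_le_scaled)
    fix e :: real assume "e > 0"
    with der2 obtain d where d: "d > 0"
      "\<And>x. x \<in> S \<Longrightarrow> norm (x - z) < d \<Longrightarrow> norm (f' x - f' z - f'' (x - z)) \<le> e * norm (x - z)"
      by (auto simp: has_derivative_within_alt)
    have "(\<lambda>n. t n *\<^sub>R k n) \<longlonglongrightarrow> 0"
      using tendsto_scaleR[OF t(1) k(1)] by simp
    then have "eventually (\<lambda>n. norm (t n *\<^sub>R k n) < d) sequentially"
      using d(1) by (auto simp: tendsto_iff)
    then show "eventually (\<lambda>n. norm (X n) \<le> e * M\<^sup>2) sequentially"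
    proof (rule eventually_mono)
      fix n assume n: "norm (t n *\<^sub>R k n) < d"
      define h where "h = t n *\<^sub>R k n"
      have hS: "z + s *\<^sub>R h \<in> S" if "s \<in> {0..1}" for s
      proof -
        have "(1 - s) *\<^sub>R z + s *\<^sub>R (z + h) \<in> S"
          using S k(2)[of n] that by (intro convexD) (auto simp: h_def)
        then show ?thesis by (simp add: algebra_simps)
      qed
      have "norm (f (z + 1 *\<^sub>R h) - f (z + 0 *\<^sub>R h) - f' z h - (1/2) *\<^sub>R f'' h h) \<le> e * (norm h)\<^sup>2"
      proof (rule second_order_mean_value)
        fix s :: real assume s: "s \<in> {0..1}"
        show "((\<lambda>s. f (z + s *\<^sub>R h)) has_vector_derivative f' (z + s *\<^sub>R h) h) (at s within {0..1})"
          using S k(2)[of n] s der[OF hS[OF s]]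
          by (intro has_vector_derivative_along_segment) (auto simp: h_def)
        have sh: "norm (s *\<^sub>R h) \<le> norm h" using s by (auto simp: mult_left_le_one_le)
        \<comment> \<open>Differentiability of \<open>f'\<close> at \<open>z\<close> makes
          \<open>f'\<close> affine along the segment, up to e times the length of
          \<open>h\<close>.\<close>
        have "norm (f' (z + s *\<^sub>R h) - f' z - f'' (s *\<^sub>R h)) \<le> e * norm (s *\<^sub>R h)"
          using d(2)[OF hS[OF s]] sh n by (simp add: h_def)
        also have "\<dots> \<le> e * norm h" using sh \<open>e > 0\<close> by simp
        finally have "norm (blinfun_apply (f' (z + s *\<^sub>R h) - f' z - f'' (s *\<^sub>R h)) h)
            \<le> e * norm h * norm h"
          by (meson norm_blinfun order_trans mult_right_mono norm_ge_zero)
        then show "norm (f' (z + s *\<^sub>R h) h - f' z h - s *\<^sub>R f'' h h) \<le> e * (norm h)\<^sup>2"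
          by (simp add: blinfun.diff_left blinfun.scaleR_left blinfun.scaleR_right power2_eq_square mult.assoc)
      qed
      also have "\<dots> \<le> e * ((t n)\<^sup>2 * M\<^sup>2)"
        using \<open>e > 0\<close> M(2)[of n] by (auto simp: h_def power_mult_distrib intro!: mult_left_mono power_mono)
      finally have "(1 / (t n)\<^sup>2) * norm (f (z + h) - f z - f' z h - (1/2) *\<^sub>R f'' h h) \<le> e * M\<^sup>2"
        using t(2)[of n] by (simp add: divide_simps mult.commute mult.left_commute)
      moreover have "X n = (1 / (t n)\<^sup>2) *\<^sub>R (f (z + h) - f z - f' z h - (1/2) *\<^sub>R f'' h h)"
        using t(2)[of n]
        by (simp add: X_def h_def blinfun.scaleR_left blinfun.scaleR_right scaleR_diff_right power2_eq_square)
      ultimately show "norm (X n) \<le> e * M\<^sup>2" by simp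
    qed
  qed
  moreover have "(\<lambda>n. (1/2) *\<^sub>R f'' (k n) (k n)) \<longlonglongrightarrow> (1/2) *\<^sub>R f'' k0 k0"
    by (intro tendsto_intros k)
  ultimately have "(\<lambda>n. X n + (1/2) *\<^sub>R f'' (k n) (k n)) \<longlonglongrightarrow> 0 + (1/2) *\<^sub>R f'' k0 k0"
    by (rule tendsto_add)
  then show ?thesis by (simp add: X_def)
qed

text \<open>Only the gradient carries regularity in time, so the value at \<open>y\<close> is
  subtracted at the same time \<open>t n\<close>. The term \<open>inner b x0\<close> stems from the
  drift of the gradient in time.\<close>

lemma partial_gradient_expansion:
  fixes g :: "real \<Rightarrow> 'a::real_inner \<Rightarrow> real" and G :: "real \<Rightarrow> 'a \<Rightarrow> 'a"
  assumes grad: "\<And>t x. t \<ge> 0 \<Longrightarrow> GDERIV (g t) x :> G t x"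
    and der: "((\<lambda>(t, x). G t x) has_derivative (\<lambda>(\<tau>, h). \<tau> *\<^sub>R b + H h)) (at (0, y) within {0..} \<times> UNIV)"
    and t: "t \<longlonglongrightarrow> 0" "\<And>n. t n > 0"
    and x: "x \<longlonglongrightarrow> x0"
  shows "(\<lambda>n. (1 / (t n)\<^sup>2) * (g (t n) (y + t n *\<^sub>R x n) - g (t n) y - t n * inner (G 0 y) (x n)))
    \<longlonglongrightarrow> 1/2 * inner (H x0) x0 + inner b x0"
proof -
  define X where "X = (\<lambda>n. (1 / (t n)\<^sup>2) * (g (t n) (y + t n *\<^sub>R x n) - g (t n) y - t n * inner (G 0 y) (x n))
    - (1/2 * inner (H (x n)) (x n) + inner b (x n)))"
  have "bounded_linear (\<lambda>h. (\<lambda>(\<tau>, h). \<tau> *\<^sub>R b + H h) (0, h))"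
    by (rule bounded_linear_compose[OF has_derivative_bounded_linear[OF der]])
      (intro bounded_linear_intros)
  then have H: "bounded_linear H" by simp
  then have linH: "linear H" by (rule bounded_linear.linear)
  obtain M where M: "M > 0" "\<And>n. norm (x n) \<le> M"
    by (rule LIMSEQ_norm_bounded[OF x]) blast
  have "X \<longlonglongrightarrow> 0"
  proof (rule tendsto_zero_if_norm_le_scaled)
    fix e :: real assume "e > 0"
    with der obtain d where "d > 0"
      and dz: "\<forall>z\<in>{0..} \<times> UNIV. norm (z - (0, y)) < d \<longrightarrow>
        norm ((\<lambda>(t, x). G t x) z - (\<lambda>(t, x). G t x) (0, y) - (\<lambda>(\<tau>, h). \<tau> *\<^sub>R b + H h) (z - (0, y)))
          \<le> e * norm (z - (0, y))"
      unfolding has_derivative_within_alt by blast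
    have d: "norm (G \<tau> (y + h) - G 0 y - (\<tau> *\<^sub>R b + H h)) \<le> e * norm (\<tau>, h)"
      if "\<tau> \<ge> 0" "norm (\<tau>, h) < d" for \<tau> h
      using bspec[OF dz, of "(\<tau>, y + h)"] that by simp
    have "(\<lambda>n. t n * (1 + M)) \<longlonglongrightarrow> 0"
      using tendsto_mult_left_zero[OF t(1)] by simp
    then have "eventually (\<lambda>n. t n * (1 + M) < d) sequentially"
      using \<open>d > 0\<close> by (auto dest: order_tendstoD)
    then show "eventually (\<lambda>n. norm (X n) \<le> e * ((1 + M) * M)) sequentially"
    proof (rule eventually_mono)
      fix n assume n: "t n * (1 + M) < d"
      define h where "h = t n *\<^sub>R x n"
      have tn: "t n > 0" by (rule t)
      have nh: "norm h \<le> t n * M" using M(2)[of n] tn by (simp add: h_def)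
      \<comment> \<open>The factor \<open>t n * (1 + M)\<close> bounds the joint displacement in
        time and space at which the gradient is expanded; \<open>t n * M\<close> bounds the
        \<open>h\<close> paired with it.\<close>
      have "norm (g (t n) (y + 1 *\<^sub>R h) - g (t n) (y + 0 *\<^sub>R h) - (inner (G 0 y) h + t n * inner b h)
          - (1/2) *\<^sub>R inner (H h) h) \<le> e * (t n * (1 + M)) * (t n * M)"
      proof (rule second_order_mean_value)
        fix s :: real assume s: "s \<in> {0..1}"
        have "(g (t n) has_derivative (\<lambda>k. inner k (G (t n) (y + s *\<^sub>R h)))) (at (y + s *\<^sub>R h) within UNIV)"
          using grad[of "t n"] tn by (simp add: gderiv_def inner_commute)
        then show "((\<lambda>s. g (t n) (y + s *\<^sub>R h)) has_vector_derivative inner h (G (t n) (y + s *\<^sub>R h)))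
            (at s within {0..1})"
          using s by (intro has_vector_derivative_along_segment[where S = UNIV]) auto
        have sh: "norm (s *\<^sub>R h) \<le> norm h" using s by (auto simp: mult_left_le_one_le)
        have le: "norm (t n, s *\<^sub>R h) \<le> t n * (1 + M)"
          using norm_Pair_le[of "t n" "s *\<^sub>R h"] sh nh tn by (simp add: algebra_simps)
        have "norm (G (t n) (y + s *\<^sub>R h) - G 0 y - (t n *\<^sub>R b + H (s *\<^sub>R h))) \<le> e * norm (t n, s *\<^sub>R h)"
          using d[of "t n" "s *\<^sub>R h"] tn le n by simp
        also have "\<dots> \<le> e * (t n * (1 + M))" using le \<open>e > 0\<close> by simp
        finally have "norm (inner (G (t n) (y + s *\<^sub>R h) - G 0 y - (t n *\<^sub>R b + H (s *\<^sub>R h))) h)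
            \<le> e * (t n * (1 + M)) * (t n * M)"
          using nh M(1) tn \<open>e > 0\<close>
          by (intro order_trans[OF Cauchy_Schwarz_ineq2[folded real_norm_def]] mult_mono) auto
        then show "norm (inner h (G (t n) (y + s *\<^sub>R h)) - (inner (G 0 y) h + t n * inner b h)
            - s *\<^sub>R inner (H h) h) \<le> e * (t n * (1 + M)) * (t n * M)"
          by (simp add: inner_diff_left inner_add_left linear_scale[OF linH] inner_commute algebra_simps)
      qed
      then have "(1 / (t n)\<^sup>2) * \<bar>g (t n) (y + h) - g (t n) y - (inner (G 0 y) h + t n * inner b h)
          - (1/2) * inner (H h) h\<bar> \<le> e * ((1 + M) * M)"
        using tn by (simp add: divide_simps power2_eq_square mult.commute mult.left_commute)
      moreover have "X n = (1 / (t n)\<^sup>2) * (g (t n) (y + h) - g (t n) y - (inner (G 0 y) h + t n * inner b h)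
          - (1/2) * inner (H h) h)"
        using tn by (simp add: X_def h_def linear_scale[OF linH] field_simps power2_eq_square)
      ultimately show "norm (X n) \<le> e * ((1 + M) * M)"
        by (simp add: abs_mult)
    qed
  qed
  moreover have "(\<lambda>n. 1/2 * inner (H (x n)) (x n) + inner b (x n)) \<longlonglongrightarrow> 1/2 * inner (H x0) x0 + inner b x0"
    by (intro tendsto_intros x bounded_linear.tendsto[OF H])
  ultimately have "(\<lambda>n. X n + (1/2 * inner (H (x n)) (x n) + inner b (x n)))
      \<longlonglongrightarrow> 0 + (1/2 * inner (H x0) x0 + inner b x0)"
    by (rule tendsto_add)
  then show ?thesis by (simp add: X_def)
qed

section \<open>Strong convexity and gradients\<close>

text \<open>Along the segment from \<open>x\<close> to \<open>z\<close>, the function minus its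
  affine part and the quadratic is nondecreasing, because strong monotonicity makes its derivative
  nonnegative.\<close>

lemma strongly_convex_lower_bound:
  fixes f :: "'a::real_inner \<Rightarrow> real"
  assumes grad: "\<And>x. GDERIV f x :> G x" and mono: "strongly_monotone_with \<alpha> G"
  shows "f z \<ge> f x + inner (G x) (z - x) + \<alpha> / 2 * (norm (z - x))\<^sup>2"
proof -
  define h where "h = z - x"
  define \<psi> where "\<psi> = (\<lambda>s. f (x + s *\<^sub>R h) - s * inner (G x) h - \<alpha> / 2 * s\<^sup>2 * (norm h)\<^sup>2)"
  have "\<psi> 0 \<le> \<psi> 1"
  proof (rule DERIV_nonneg_imp_nondecreasing[where f = \<psi>])
    fix s :: real assume s: "0 \<le> s" "s \<le> 1"
    have "((\<lambda>s. f (x + s *\<^sub>R h)) has_derivative (\<lambda>r. inner (r *\<^sub>R h) (G (x + s *\<^sub>R h)))) (at s)"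
      by (rule has_derivative_compose[where f = "\<lambda>s. x + s *\<^sub>R h"])
        (auto intro!: derivative_eq_intros grad[unfolded gderiv_def])
    then have "((\<lambda>s. f (x + s *\<^sub>R h)) has_real_derivative inner h (G (x + s *\<^sub>R h))) (at s)"
      by (rule has_derivative_imp_has_field_derivative) (simp add: mult.commute)
    then have "(\<psi> has_real_derivative inner h (G (x + s *\<^sub>R h)) - inner (G x) h - \<alpha> * s * (norm h)\<^sup>2) (at s)"
      unfolding \<psi>_def by (auto intro!: derivative_eq_intros)
    moreover have "inner h (G (x + s *\<^sub>R h)) - inner (G x) h - \<alpha> * s * (norm h)\<^sup>2 \<ge> 0"
    proof (cases "s = 0")
      case False
      \<comment> \<open>Monotonicity between \<open>x\<close> and the point at parameter s yields
        the wanted inequality times s, hence the separate case \<open>s = 0\<close>.\<close>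
      have "inner (G (x + s *\<^sub>R h) - G x) (s *\<^sub>R h) \<ge> \<alpha> * (norm (s *\<^sub>R h))\<^sup>2"
        using mono[unfolded strongly_monotone_with_def, rule_format, where ?x1.0 = x and ?x2.0 = "x + s *\<^sub>R h"] by simp
      then have "s * (inner h (G (x + s *\<^sub>R h)) - inner (G x) h) \<ge> s * (\<alpha> * s * (norm h)\<^sup>2)"
        by (simp add: inner_diff_left inner_commute power_mult_distrib power2_eq_square algebra_simps)
      then show ?thesis using False s by simp
    qed (simp add: inner_commute)
    ultimately show "\<exists>y. (\<psi> has_real_derivative y) (at s) \<and> 0 \<le> y" by blast
  qed auto
  then show ?thesis by (simp add: \<psi>_def h_def)
qed

text \<open>The gradient is the Riesz representer of the derivative, assembled from its values on
  \<open>Basis\<close>; uniqueness is what the definite description in \<open>grad\<close>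
  requires.\<close>

lemma GDERIV_grad:
  fixes f :: "'a::euclidean_space \<Rightarrow> real"
  assumes "f differentiable (at x)"
  shows "GDERIV f x :> grad f x"
proof -
  obtain f' where f': "(f has_derivative f') (at x)"
    using assms by (auto simp: differentiable_def)
  have lin: "linear f'" using f' by (rule has_derivative_linear)
  define D where "D = (\<Sum>b\<in>Basis. f' b *\<^sub>R b)"
  have "f' h = inner h D" for h
  proof -
    have "f' h = f' (\<Sum>b\<in>Basis. inner h b *\<^sub>R b)" by (simp add: euclidean_representation)
    also have "\<dots> = inner h D"
      by (simp add: linear_sum[OF lin] linear_scale[OF lin] D_def inner_sum_right mult.commute)
    finally show ?thesis .
  qed
  then have "f' = (\<lambda>h. inner h D)" by (rule ext)
  with f' have "GDERIV f x :> D" by (simp add: gderiv_def)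
  moreover have "E = D" if "GDERIV f x :> E" for E
  proof -
    have "(\<lambda>h. inner h E) = (\<lambda>h. inner h D)"
      using that calculation by (auto simp: gderiv_def intro: has_derivative_unique)
    then have "inner (E - D) E = inner (E - D) D" by (rule fun_cong)
    then have "inner (E - D) (E - D) = 0" by (simp add: inner_diff_right)
    then show ?thesis by simp
  qed
  ultimately show ?thesis unfolding grad_def by (rule theI)
qed

section \<open>A theorem of the alternative for strict linear systems\<close>

text \<open>The multipliers are read off a hyperplane separating the range of the affine map
  \<open>\<xi> \<mapsto> (J \<xi> + u, \<langle>c, \<xi>\<rangle> - \<beta>)\<close> from the cone of pairs that are negative in the coordinates \<open>I\<close>
  and in the last one.\<close>

lemma strict_system_alternative:
  fixes J :: "real ^ 'm ^ 'd" and u :: "real ^ 'd" and c :: "real ^ 'm"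
  assumes none: "\<nexists>\<xi>. (\<forall>i\<in>I. (J *v \<xi>) $ i + u $ i < 0) \<and> inner c \<xi> < \<beta>"
  obtains w l where "w \<noteq> 0 \<or> l \<noteq> 0" "l \<ge> 0" "\<And>i. w $ i \<ge> 0" "\<And>i. i \<notin> I \<Longrightarrow> w $ i = 0"
    "transpose J *v w + l *\<^sub>R c = 0" "l * \<beta> \<le> inner w u"
proof -
  define S where "S = range (\<lambda>\<xi>. (J *v \<xi> + u, inner c \<xi> - \<beta>))"
  \<comment> \<open>Coordinates outside \<open>I\<close> are left free, which later forces
    \<open>w\<close> to vanish there.\<close>
  define T where "T = {(p :: real ^ 'd, s :: real). (\<forall>i\<in>I. p $ i < 0) \<and> s < 0}"
  have "convex S"
  proof -
    have "S = (\<lambda>p. (u, - \<beta>) + p) ` range (\<lambda>\<xi>. (J *v \<xi>, inner c \<xi>))"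
      by (auto simp: S_def image_image add.commute)
    moreover have "linear (\<lambda>\<xi>. (J *v \<xi>, inner c \<xi>))"
      by (intro linearI) (auto simp: matrix_vector_right_distrib inner_add_right matrix_vector_mult_scaleR)
    ultimately show ?thesis by (simp add: convex_linear_image convex_translation)
  qed
  moreover have "convex T"
  proof (rule convexI)
    fix p q :: "(real ^ 'd) \<times> real" and a b :: real
    assume "p \<in> T" "q \<in> T" "0 \<le> a" "0 \<le> b" "a + b = 1"
    have neg: "a * r + b * s < 0" if "r < 0" "s < 0" for r s :: real
    proof (cases "a = 0")
      case False
      then have "a * r < 0" "b * s \<le> 0" using that \<open>0 \<le> a\<close> \<open>0 \<le> b\<close>
        by (auto simp: mult_pos_neg mult_nonneg_nonpos)
      then show ?thesis by linarith
    qed (use \<open>a + b = 1\<close> that in auto)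
    from \<open>p \<in> T\<close> \<open>q \<in> T\<close> show "a *\<^sub>R p + b *\<^sub>R q \<in> T"
      by (auto simp: T_def neg split: prod.splits)
  qed
  moreover have "S \<inter> T = {}"
  proof -
    have "p \<notin> T" if "p \<in> S" for p
    proof -
      from that obtain \<xi> where "p = (J *v \<xi> + u, inner c \<xi> - \<beta>)" unfolding S_def by blast
      moreover have "\<not> ((\<forall>i\<in>I. (J *v \<xi>) $ i + u $ i < 0) \<and> inner c \<xi> < \<beta>)" using none by blast
      ultimately show ?thesis by (simp add: T_def)
    qed
    then show ?thesis by blast
  qed
  moreover have "S \<noteq> {}" by (simp add: S_def)
  moreover have negT: "(- \<epsilon> *\<^sub>R 1, - \<epsilon>) \<in> T" if "\<epsilon> > 0" for \<epsilon> using that by (auto simp: T_def)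
  then have "T \<noteq> {}" using zero_less_one by blast
  ultimately obtain a b where ab: "a \<noteq> 0" "\<forall>p\<in>S. inner a p \<le> b" "\<forall>p\<in>T. inner a p \<ge> b"
    using separating_hyperplane_sets[of S T] by blast
  \<comment> \<open>The separating functional is bounded below on \<open>T\<close>, whose
    constrained coordinates are negative; reversing its sign produces nonnegative
    multipliers.\<close>
  define w l where "w = - fst a" and "l = - snd a"
  have a: "inner a (p, s) = - (inner w p + l * s)" for p s
    by (cases a) (simp add: w_def l_def)
  have T0: "inner w p + l * s \<le> - b" if "(p, s) \<in> T" for p s
    using ab(3) that a by fastforce
  have T1: "inner w p + l * s \<le> 0" if "(p, s) \<in> T" for p s
  proof (rule nonpos_if_multiples_bounded)
    fix N :: real assume "N > 0"
    then have "(N *\<^sub>R p, N * s) \<in> T" using that by (auto simp: T_def mult_pos_neg)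
    from T0[OF this] show "N * (inner w p + l * s) \<le> - b" by (simp add: algebra_simps)
  qed
  \<comment> \<open>Passage to weak inequalities: every positive multiple of such a point enters
    \<open>T\<close> after subtracting 1 from each coordinate.\<close>
  have T2: "inner w p + l * s \<le> 0" if "\<forall>i\<in>I. p $ i \<le> 0" "s \<le> 0" for p s
  proof (rule nonpos_if_multiples_bounded)
    fix N :: real assume N: "N > 0"
    have "N * r < 1" if "r \<le> 0" for r :: real
      using mult_nonneg_nonpos[of N r] N that by linarith
    then have "(N *\<^sub>R p - 1, N * s - 1) \<in> T" using that by (auto simp: T_def)
    from T1[OF this] show "N * (inner w p + l * s) \<le> inner w 1 + l"
      by (simp add: algebra_simps inner_diff_right)
  qed
  \<comment> \<open>\<open>T\<close> contains points arbitrarily close to the origin.\<close>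
  have "b \<le> 0"
  proof (rule nonpos_if_multiples_bounded)
    fix N :: real assume N: "N > 0"
    have "inner w (- (1 / N) *\<^sub>R 1) + l * (- (1 / N)) \<le> - b" using N by (intro T0 negT) auto
    then show "N * b \<le> inner w 1 + l" using N by (simp add: field_simps)
  qed
  define p where "p = transpose J *v w + l *\<^sub>R c"
  have S0: "inner p \<xi> + inner w u - l * \<beta> \<ge> 0" for \<xi>
  proof -
    have "inner a (J *v \<xi> + u, inner c \<xi> - \<beta>) \<le> b" using ab(2) by (auto simp: S_def)
    with \<open>b \<le> 0\<close> show ?thesis
      by (simp add: a p_def inner_add_left inner_add_right dot_lmul_matrix algebra_simps)
  qed
  \<comment> \<open>An affine function of \<xi> that is bounded below has zero linear part.\<close>
  have "inner p p \<le> 0"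
  proof (rule nonpos_if_multiples_bounded)
    fix N :: real assume "N > 0"
    show "N * inner p p \<le> inner w u - l * \<beta>" using S0[of "- N *\<^sub>R p"] by simp
  qed
  then have p0: "p = 0" by (metis inner_gt_zero_iff not_less)
  show thesis
  proof
    show "w \<noteq> 0 \<or> l \<noteq> 0" using ab(1) by (auto simp: w_def l_def prod_eq_iff)
    show "l \<ge> 0" using T2[of 0 "-1"] by simp
    show w0: "w $ i \<ge> 0" for i
    proof -
      have "\<forall>j\<in>I. (- axis i 1 :: real ^ 'd) $ j \<le> 0" by (auto simp: axis_def)
      from T2[OF this order_refl] show ?thesis by (simp add: inner_axis)
    qed
    show "w $ i = 0" if "i \<notin> I" for i
    proof -
      have "\<forall>j\<in>I. (axis i 1 :: real ^ 'd) $ j \<le> 0" using that by (auto simp: axis_def)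
      from T2[OF this order_refl] show ?thesis using w0[of i] by (simp add: inner_axis)
    qed
    show "transpose J *v w + l *\<^sub>R c = 0" using p0 by (simp add: p_def)
    show "l * \<beta> \<le> inner w u" using S0[of 0] by simp
  qed
qed

section \<open>Normal and tangent cones of the orthant\<close>

text \<open>The cone is tested along coordinate axes: a step of -1 gives the sign, and moving
  coordinate \<open>i\<close> to zero gives complementarity.\<close>

lemma mem_normal_cone_nonpos_orthant:
  fixes w z :: "real ^ 'd"
  assumes w: "w \<in> nonpos_orthant"
  shows "z \<in> normal_cone nonpos_orthant w \<longleftrightarrow> (\<forall>i. z $ i \<ge> 0 \<and> z $ i * w $ i = 0)"
proof (intro iffI allI)
  fix i assume z: "z \<in> normal_cone nonpos_orthant w"
  have *: "inner z (s *\<^sub>R axis i 1) \<le> 0" if "s + w $ i \<le> 0" for s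
  proof -
    have "w + s *\<^sub>R axis i 1 \<in> nonpos_orthant"
      using w that by (auto simp: nonpos_orthant_def axis_def add.commute)
    with z show ?thesis by (force simp: normal_cone_def)
  qed
  have wi: "w $ i \<le> 0" using w by (auto simp: nonpos_orthant_def)
  have zi: "z $ i \<ge> 0" using *[of "-1"] wi by (simp add: inner_axis)
  have "z $ i * w $ i \<ge> 0" using *[of "- w $ i"] by (simp add: inner_axis mult.commute)
  moreover have "z $ i * w $ i \<le> 0" using zi wi by (rule mult_nonneg_nonpos)
  ultimately show "z $ i \<ge> 0 \<and> z $ i * w $ i = 0" using zi by simp
next
  assume z: "\<forall>i. z $ i \<ge> 0 \<and> z $ i * w $ i = 0"
  show "z \<in> normal_cone nonpos_orthant w"
    unfolding normal_cone_def
  proof safe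
    fix u :: "real ^ 'd" assume "u \<in> nonpos_orthant"
    then have "z $ i * u $ i \<le> 0" for i
      using z by (simp add: nonpos_orthant_def mult_nonneg_nonpos)
    then have "z $ i * (u $ i - w $ i) \<le> 0" for i
      using z by (metis diff_zero right_diff_distrib)
    then show "inner z (u - w) \<le> 0"
      by (auto simp: inner_vec_def intro!: sum_nonpos)
  qed
qed

text \<open>The right-hand side is a closed cone containing the generators. Conversely, inactive
  coordinates have slack, so \<open>w + s *\<^sub>R h\<close> stays in the orthant for some
  \<open>s > 0\<close>, and \<open>h\<close> is a positive multiple of a generator.\<close>

lemma mem_tangent_cone_nonpos_orthant:
  fixes w h :: "real ^ 'd"
  assumes w: "w \<in> nonpos_orthant"
  shows "h \<in> tangent_cone nonpos_orthant w \<longleftrightarrow> (\<forall>i. w $ i = 0 \<longrightarrow> h $ i \<le> 0)"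
proof
  define C where "C = {h :: real ^ 'd. \<forall>i. w $ i = 0 \<longrightarrow> h $ i \<le> 0}"
  have "closed C" unfolding C_def
    by (intro closed_Collect_all closed_Collect_imp closed_Collect_le open_Collect_const)
      (auto intro!: continuous_intros)
  moreover have "cone C" by (auto simp: cone_def C_def mult_nonneg_nonpos)
  moreover have "(\<lambda>u. u - w) ` nonpos_orthant \<subseteq> C"
    by (auto simp: C_def nonpos_orthant_def)
  ultimately have "tangent_cone nonpos_orthant w \<subseteq> C"
    unfolding tangent_cone_def by (intro closure_minimal hull_minimal)
  moreover assume "h \<in> tangent_cone nonpos_orthant w"
  ultimately show "\<forall>i. w $ i = 0 \<longrightarrow> h $ i \<le> 0" by (auto simp: C_def)
next
  assume h: "\<forall>i. w $ i = 0 \<longrightarrow> h $ i \<le> 0"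
  have "eventually (\<lambda>s. \<forall>i. w $ i + s * h $ i \<le> 0) (at_right 0)"
  proof (rule eventually_all_finite)
    fix i
    show "eventually (\<lambda>s. w $ i + s * h $ i \<le> 0) (at_right 0)"
    proof (cases "w $ i = 0")
      case True
      with h show ?thesis
        by (auto intro!: eventually_mono[OF eventually_at_right_less] simp: mult_nonneg_nonpos)
    next
      case False
      with w have "w $ i < 0" by (auto simp: nonpos_orthant_def less_le)
      moreover have "((\<lambda>s. w $ i + s * h $ i) \<longlongrightarrow> w $ i + 0 * h $ i) (at_right 0)"
        by (intro tendsto_intros)
      ultimately have "eventually (\<lambda>s. w $ i + s * h $ i < 0) (at_right 0)"
        by (auto dest: order_tendstoD(2))
      then show ?thesis by (rule eventually_mono) simp
    qed
  qed
  from eventually_conj[OF this eventually_at_right_less]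
  obtain s :: real where s: "\<forall>i. w $ i + s * h $ i \<le> 0" "s > 0"
    using eventually_happens'[OF trivial_limit_at_right_real] by blast
  then have "w + s *\<^sub>R h \<in> nonpos_orthant" by (simp add: nonpos_orthant_def)
  then have "(1 / s) *\<^sub>R ((w + s *\<^sub>R h) - w) \<in> cone hull ((\<lambda>u. u - w) ` nonpos_orthant)"
    using s by (intro mem_cone_hull imageI) auto
  then show "h \<in> tangent_cone nonpos_orthant w"
    using s closure_subset by (auto simp: tangent_cone_def)
qed

section \<open>Feasible sets and unique minimisers\<close>

lemma convex_on_if_Gamma0:
  fixes f :: "real \<Rightarrow> real ^ 'm \<Rightarrow> real"
  assumes "(\<lambda>t x. ereal (f t x)) \<in> Gamma0" "t \<ge> 0"
  shows "convex_on UNIV (f t)"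
proof -
  have "convex_fun (\<lambda>x. ereal (f t x))" using assms by (auto simp: Gamma0_def)
  then have "ereal (f t (u *\<^sub>R x + v *\<^sub>R y)) \<le> ereal u * ereal (f t x) + ereal v * ereal (f t y)"
    if "u \<ge> 0" "v \<ge> 0" "u + v = 1" for u v x y
    using that unfolding convex_fun_def by blast
  then show ?thesis by (auto simp: convex_on_def)
qed

lemma convex_sublevel_set:
  assumes "convex_on S f"
  shows "convex {x \<in> S. f x \<le> c}"
proof (rule convexI)
  fix x y and u v :: real
  assume xy: "x \<in> {x \<in> S. f x \<le> c}" "y \<in> {x \<in> S. f x \<le> c}" and uv: "0 \<le> u" "0 \<le> v" "u + v = 1"
  have "f (u *\<^sub>R x + v *\<^sub>R y) \<le> u * f x + v * f y"
    using assms xy uv by (auto simp: convex_on_def)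
  also have "\<dots> \<le> u * c + v * c" using xy uv by (intro add_mono mult_left_mono) auto
  also have "\<dots> = c" using uv by (simp flip: distrib_right)
  finally show "u *\<^sub>R x + v *\<^sub>R y \<in> {x \<in> S. f x \<le> c}"
    using assms xy uv by (auto simp: convex_on_def intro: convexD)
qed

text \<open>Closedness rests on the continuity of finite convex functions on the whole
  space.\<close>

lemma feasible_set_convex_closed:
  fixes F :: "real \<Rightarrow> real ^ 'm \<Rightarrow> real ^ 'd"
  assumes conv: "\<And>i. convex_on UNIV (\<lambda>x. F t x $ i)"
  shows "convex (feasible_set F t)" "closed (feasible_set F t)"
proof -
  have eq: "feasible_set F t = (\<Inter>i. {x \<in> UNIV. F t x $ i \<le> 0})"
    by (auto simp: feasible_set_def nonpos_orthant_def)
  show "convex (feasible_set F t)" unfolding eq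
    by (intro convex_INT convex_sublevel_set conv)
  have "continuous_on UNIV (\<lambda>x. F t x $ i)" for i
    by (intro convex_on_continuous conv) auto
  then show "closed (feasible_set F t)" unfolding eq
    by (auto intro!: closed_INT closed_Collect_le continuous_on_const)
qed

lemma is_arg_min_iff:
  fixes f :: "'a \<Rightarrow> 'b::linorder"
  shows "is_arg_min f P x \<longleftrightarrow> P x \<and> (\<forall>z. P z \<longrightarrow> f x \<le> f z)"
  by (auto simp: is_arg_min_def not_less)

text \<open>Quadratic growth makes a sublevel set compact, whence existence; a comparison with the
  midpoint gives uniqueness.\<close>

lemma strongly_convex_unique_arg_min:
  fixes f :: "'a::euclidean_space \<Rightarrow> real"
  assumes grad: "\<And>x. GDERIV f x :> G x" and mono: "strongly_monotone_with \<alpha> G" "\<alpha> > 0"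
    and S: "convex S" "closed S" "S \<noteq> {}"
  shows "\<exists>!x. is_arg_min f (\<lambda>x. x \<in> S) x"
proof -
  note lower = strongly_convex_lower_bound[OF grad mono(1)]
  have cont: "continuous_on A f" for A
    using has_derivative_continuous[OF grad[unfolded gderiv_def]]
    by (auto intro: continuous_at_imp_continuous_on)
  obtain x0 where x0: "x0 \<in> S" using S by blast
  define L where "L = S \<inter> {x. f x \<le> f x0}"
  \<comment> \<open>The radius comes from the quadratic lower bound at \<open>x0\<close>, the value
    at \<open>x\<close> not exceeding the one at \<open>x0\<close>.\<close>
  have "L \<subseteq> cball x0 (2 * norm (G x0) / \<alpha>)"
  proof
    fix x assume "x \<in> L"
    then have "\<alpha> / 2 * (norm (x - x0))\<^sup>2 \<le> - inner (G x0) (x - x0)"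
      using lower[of x0 x] by (simp add: L_def)
    also have "\<dots> \<le> norm (G x0) * norm (x - x0)"
      using Cauchy_Schwarz_ineq2[of "G x0" "x - x0"] by linarith
    finally have "norm (x - x0) * (\<alpha> / 2 * norm (x - x0)) \<le> norm (x - x0) * norm (G x0)"
      by (simp add: power2_eq_square mult_ac)
    then have "x = x0 \<or> \<alpha> / 2 * norm (x - x0) \<le> norm (G x0)"
      using mult_le_cancel_left_pos[of "norm (x - x0)"] by (cases "x = x0") auto
    then show "x \<in> cball x0 (2 * norm (G x0) / \<alpha>)"
      using mono(2) by (auto simp: dist_norm norm_minus_commute field_simps)
  qed
  moreover have "closed L" unfolding L_def
    by (intro closed_Int S closed_Collect_le cont) auto
  ultimately have "compact L"
    by (meson bounded_cball bounded_subset compact_eq_bounded_closed)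
  moreover have "x0 \<in> L" using x0 by (simp add: L_def)
  ultimately obtain x where x: "x \<in> L" "\<forall>z\<in>L. f x \<le> f z"
    using continuous_attains_inf[OF _ _ cont, of L] by blast
  have "f x \<le> f z" if "z \<in> S" for z
    using x that by (cases "f z \<le> f x0") (auto simp: L_def)
  then have min: "is_arg_min f (\<lambda>x. x \<in> S) x" using x by (auto simp: is_arg_min_iff L_def)
  moreover have "x1 = x2" if "is_arg_min f (\<lambda>x. x \<in> S) x1" "is_arg_min f (\<lambda>x. x \<in> S) x2" for x1 x2
  proof -
    \<comment> \<open>The lower bound is centred at the midpoint: when the bounds towards
      \<open>x1\<close> and \<open>x2\<close> are added, the gradient terms cancel.\<close>
    define m where "m = (1/2) *\<^sub>R x1 + (1/2) *\<^sub>R x2"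
    have "m \<in> S" using that S unfolding m_def by (intro convexD) (auto simp: is_arg_min_iff)
    then have "f x1 \<le> f m" "f x2 \<le> f m" using that by (auto simp: is_arg_min_iff)
    moreover have "x1 - m = (1/2) *\<^sub>R (x1 - x2)" "x2 - m = - (1/2) *\<^sub>R (x1 - x2)"
      by (auto simp: m_def algebra_simps simp flip: scaleR_left_distrib)
    ultimately have "\<alpha> * (norm (x1 - x2))\<^sup>2 \<le> 0"
      using lower[of m x1] lower[of m x2] by (simp add: power_divide)
    then show ?thesis using mono(2) by (simp add: mult_le_0_iff)
  qed
  ultimately show ?thesis by blast
qed

section \<open>Difference quotients and partial derivatives\<close>

lemma directional_difference_quotient:
  fixes f :: "'a::real_normed_vector \<Rightarrow> 'b::real_normed_vector"
  assumes der: "(f has_derivative f') (at z within S)"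
    and t: "t \<longlonglongrightarrow> 0" "\<And>n. t n > 0" and S: "\<And>n. z + t n *\<^sub>R k \<in> S"
  shows "(\<lambda>n. (1 / t n) *\<^sub>R (f (z + t n *\<^sub>R k) - f z)) \<longlonglongrightarrow> f' k"
proof -
  have lin: "linear f'" using der by (rule has_derivative_linear)
  have "(\<lambda>n. (1 / t n) *\<^sub>R (f (z + t n *\<^sub>R k) - f z) - f' k) \<longlonglongrightarrow> 0"
  proof (rule tendsto_zero_if_norm_le_scaled)
    fix e :: real assume "e > 0"
    with der obtain d where d: "d > 0"
      "\<And>x. x \<in> S \<Longrightarrow> norm (x - z) < d \<Longrightarrow> norm (f x - f z - f' (x - z)) \<le> e * norm (x - z)"
      by (auto simp: has_derivative_within_alt)
    have "(\<lambda>n. t n *\<^sub>R k) \<longlonglongrightarrow> 0"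
      using tendsto_scaleR[OF t(1) tendsto_const] by simp
    then have "eventually (\<lambda>n. norm (t n *\<^sub>R k) < d) sequentially"
      using d(1) by (auto simp: tendsto_iff)
    then show "eventually (\<lambda>n. norm ((1 / t n) *\<^sub>R (f (z + t n *\<^sub>R k) - f z) - f' k) \<le> e * norm k) sequentially"
    proof (rule eventually_mono)
      fix n assume n: "norm (t n *\<^sub>R k) < d"
      have tn: "t n > 0" by (rule t)
      have "(1 / t n) *\<^sub>R (f (z + t n *\<^sub>R k) - f z) - f' k
          = (1 / t n) *\<^sub>R (f (z + t n *\<^sub>R k) - f z - f' (t n *\<^sub>R k))"
        using tn by (simp add: linear_scale[OF lin] scaleR_diff_right)
      also have "norm \<dots> = (1 / t n) * norm (f (z + t n *\<^sub>R k) - f z - f' (t n *\<^sub>R k))"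
        using tn by simp
      also have "\<dots> \<le> (1 / t n) * (e * norm (t n *\<^sub>R k))"
        using d(2)[OF S[of n]] n tn by (intro mult_left_mono) auto
      also have "\<dots> = e * norm k" using tn by simp
      finally show "norm ((1 / t n) *\<^sub>R (f (z + t n *\<^sub>R k) - f z) - f' k) \<le> e * norm k" .
    qed
  qed
  then show ?thesis by (simp add: LIM_zero_iff)
qed

lemma norm_le_if_scaled:
  fixes x :: "'a::real_normed_vector"
  assumes "norm ((1 / r) *\<^sub>R x) \<le> B" "r > 0"
  shows "norm x \<le> B * r"
  using assms by (simp add: pos_divide_le_eq)

text \<open>Restriction to the line through \<open>x\<close> in direction \<open>h\<close> reduces
  this to the tangent inequality in one variable.\<close>

lemma convex_on_gradient_inequality:
  fixes f :: "'a::real_normed_vector \<Rightarrow> real"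
  assumes conv: "convex_on UNIV f" and der: "(f has_derivative f') (at x)"
  shows "f x + f' h \<le> f (x + h)"
proof -
  have "convex_on UNIV (\<lambda>s::real. f (x + s *\<^sub>R h))"
  proof (rule convex_onI)
    fix t r s :: real assume "0 < t" "t < 1"
    then have "f ((1 - t) *\<^sub>R (x + r *\<^sub>R h) + t *\<^sub>R (x + s *\<^sub>R h))
        \<le> (1 - t) * f (x + r *\<^sub>R h) + t * f (x + s *\<^sub>R h)"
      using conv by (intro convex_onD) auto
    then show "f (x + ((1 - t) *\<^sub>R r + t *\<^sub>R s) *\<^sub>R h) \<le> (1 - t) * f (x + r *\<^sub>R h) + t * f (x + s *\<^sub>R h)"
      by (simp add: algebra_simps)
  qed simp
  moreover have "((\<lambda>s. f (x + s *\<^sub>R h)) has_real_derivative f' h) (at 0 within UNIV)"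
  proof (rule has_derivative_imp_has_field_derivative)
    show "((\<lambda>s. f (x + s *\<^sub>R h)) has_derivative (\<lambda>s. f' (s *\<^sub>R h))) (at 0 within UNIV)"
      by (rule has_derivative_compose[where f = "\<lambda>s. x + s *\<^sub>R h"])
        (auto intro!: derivative_eq_intros simp: der)
    show "s * f' h = f' (s *\<^sub>R h)" for s
      using has_derivative_linear[OF der] by (simp add: linear_scale)
  qed
  ultimately have "f (x + 1 *\<^sub>R h) - f (x + 0 *\<^sub>R h) \<ge> f' h * (1 - 0)"
    by (intro convex_on_imp_above_tangent[where A = UNIV]) auto
  then show ?thesis by simp
qed

lemma eventually_below_if_deriv_neg:
  fixes f :: "real \<Rightarrow> real"
  assumes "(f has_real_derivative l) (at x)" "l < 0"
  shows "eventually (\<lambda>s. f (x + s) < f x) (at_right 0)"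
proof -
  obtain d where "d > 0" "\<forall>h > 0. h < d \<longrightarrow> f x > f (x + h)"
    using DERIV_neg_dec_right[OF assms] by blast
  then show ?thesis unfolding eventually_at_right_field by (intro exI[of _ d]) simp
qed

text \<open>The slice at any \<open>t \<ge> 0\<close>, including the boundary slice at 0, lies in
  the half-space, so the spatial derivative is a full one.\<close>

lemma has_derivative_partial_space:
  fixes f :: "real \<times> 'a::real_normed_vector \<Rightarrow> 'b::real_normed_vector"
  assumes "(f has_derivative f') (at (t, x) within {0..} \<times> UNIV)" "t \<ge> 0"
  shows "((\<lambda>x. f (t, x)) has_derivative (\<lambda>h. f' (0, h))) (at x)"
proof -
  have "((\<lambda>x. (t, x)) has_derivative (\<lambda>h. (0, h))) (at x within UNIV)"
    by (auto intro!: derivative_eq_intros)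
  moreover have "(f has_derivative f') (at (t, x) within range (\<lambda>x. (t, x)))"
    using assms(2) by (intro has_derivative_subset[OF assms(1)]) auto
  ultimately show ?thesis by (rule has_derivative_in_compose)
qed

lemma vector_derivative_right_eq:
  "(f has_vector_derivative f') (at (0::real) within {0..}) \<Longrightarrow> vector_derivative f (at 0 within {0..}) = f'"
  by (rule vector_derivative_within) (simp add: at_within_Ici_at_right)

lemma vector_derivative_partial_time:
  fixes f :: "real \<times> 'a::real_normed_vector \<Rightarrow> 'b::real_normed_vector"
  assumes "(f has_derivative f') (at (0, x) within {0..} \<times> UNIV)"
  shows "vector_derivative (\<lambda>t. f (t, x)) (at 0 within {0..}) = f' (1, 0)"
proof (rule vector_derivative_right_eq)
  have "((\<lambda>t. (t, x)) has_derivative (\<lambda>s. (s, 0))) (at 0 within {0..})"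
    by (auto intro!: derivative_eq_intros)
  moreover have "(f has_derivative f') (at (0, x) within (\<lambda>t. (t, x)) ` {0..})"
    by (intro has_derivative_subset[OF assms]) auto
  ultimately have "((\<lambda>t. f (t, x)) has_derivative (\<lambda>s. f' (s, 0))) (at 0 within {0..})"
    by (rule has_derivative_in_compose)
  moreover have "(\<lambda>s. f' (s, 0)) = (\<lambda>s. s *\<^sub>R f' (1, 0))"
  proof
    fix s :: real
    show "f' (s, 0) = s *\<^sub>R f' (1, 0)"
      using linear_scale[OF has_derivative_linear[OF assms], of s "(1, 0)"] by simp
  qed
  ultimately show "((\<lambda>t. f (t, x)) has_vector_derivative f' (1, 0)) (at 0 within {0..})"
    unfolding has_vector_derivative_def by (rule has_derivative_eq_rhs)
qed

text \<open>\<open>Blinfun\<close> returns the intended map only for bounded linear arguments;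
  differentiability supplies this.\<close>

lemma has_derivative_Fderiv:
  "f differentiable (at z within S) \<Longrightarrow> (f has_derivative Fderiv S f z) (at z within S)"
  unfolding Fderiv_def frechet_derivative_works
  by (simp add: bounded_linear_Blinfun_apply has_derivative_bounded_linear)

section \<open>The perturbed program and its data at time 0\<close>

text \<open>Derivatives enter as explicit objects, with the derivative of \<open>G\<close> split
  into a time part \<open>b\<close> and a space part \<open>H\<close>. This keeps description
  operators out of the argument; the final interpretation ties them together.\<close>

locale perturbed_program =
  fixes F :: "real \<Rightarrow> real ^ 'm \<Rightarrow> real ^ 'd"
    and DF :: "real \<times> (real ^ 'm) \<Rightarrow> (real \<times> (real ^ 'm)) \<Rightarrow>\<^sub>L (real ^ 'd)"
    and D2F :: "(real \<times> (real ^ 'm)) \<Rightarrow>\<^sub>L (real \<times> (real ^ 'm)) \<Rightarrow>\<^sub>L (real ^ 'd)"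
    and g :: "real \<Rightarrow> real ^ 'm \<Rightarrow> real"
    and G :: "real \<Rightarrow> real ^ 'm \<Rightarrow> real ^ 'm"
    and b :: "real ^ 'm" and H :: "real ^ 'm \<Rightarrow> real ^ 'm"
    and \<alpha> c :: real
    and y :: "real \<Rightarrow> real ^ 'm"
  assumes F_convex: "\<And>t i. t \<ge> 0 \<Longrightarrow> convex_on UNIV (\<lambda>x. F t x $ i)"
    and F_deriv: "\<And>z. z \<in> half_space \<Longrightarrow> ((\<lambda>(t, x). F t x) has_derivative DF z) (at z within half_space)"
    and DF_deriv: "(DF has_derivative D2F) (at (0, y 0) within half_space)"
    and DF_time: "DF (0, y 0) (1, 0) = 0"
    and g_grad: "\<And>t x. t \<ge> 0 \<Longrightarrow> GDERIV (g t) x :> G t x"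
    and G_mono: "\<And>t. t \<ge> 0 \<Longrightarrow> strongly_monotone_with \<alpha> (G t)"
    and \<alpha>_pos: "\<alpha> > 0"
    and G_deriv: "((\<lambda>(t, x). G t x) has_derivative (\<lambda>(\<tau>, h). \<tau> *\<^sub>R b + H h)) (at (0, y 0) within half_space)"
    and y_min: "\<And>t. t \<ge> 0 \<Longrightarrow> is_arg_min (g t) (\<lambda>x. x \<in> feasible_set F t) (y t)"
    and y0_feasible: "\<And>t. t \<ge> 0 \<Longrightarrow> y 0 \<in> feasible_set F t"
    and c_pos: "c > 0"
    and qualification: "\<And>w. w \<in> normal_cone nonpos_orthant (F 0 (y 0)) \<Longrightarrow> norm w = 1 \<Longrightarrow>
      norm (transpose (jacobian (F 0) (at (y 0))) *v w) \<ge> c"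
begin

abbreviation J where "J \<equiv> jacobian (F 0) (at (y 0))"
abbreviation v where "v \<equiv> - G 0 (y 0)"
abbreviation K where "K \<equiv> K_set F (y 0) v"
abbreviation Y where "Y \<equiv> Y_set F (y 0) v"

definition active :: "'d set" where "active = {i. F 0 (y 0) $ i = 0}"
text \<open>The smooth part of the limit objective, that is, the limit in
  \<open>g_expansion\<close>.\<close>

definition q :: "real ^ 'm \<Rightarrow> real" where "q x = 1/2 * inner (H x) x + inner b x"
text \<open>The coefficient of \<open>s\<^sup>2\<close> in the expansion of
  \<open>F s (y 0 + s *\<^sub>R x)\<close> as s decreases to 0.\<close>

definition U :: "real ^ 'm \<Rightarrow> real ^ 'd" where "U x = (1/2) *\<^sub>R D2F (1, x) (1, x)"
text \<open>Real-valued form of the support function, justified by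
  \<open>support_fun_real\<close>.\<close>

definition \<sigma> :: "real ^ 'd \<Rightarrow> real" where "\<sigma> u = real_of_ereal (support_fun Y u)"

lemma F_le_0: "t \<ge> 0 \<Longrightarrow> F t (y t) $ i \<le> 0" "t \<ge> 0 \<Longrightarrow> F t (y 0) $ i \<le> 0"
  using y_min[of t] y0_feasible[of t]
  by (auto simp: is_arg_min_iff feasible_set_def nonpos_orthant_def)

lemma y_optimal: "t \<ge> 0 \<Longrightarrow> (\<And>i. F t x $ i \<le> 0) \<Longrightarrow> g t (y t) \<le> g t x"
  using y_min[of t] by (auto simp: is_arg_min_iff feasible_set_def nonpos_orthant_def)

lemma F0_orthant: "F 0 (y 0) \<in> nonpos_orthant"
  using F_le_0(1)[of 0] by (auto simp: nonpos_orthant_def)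

lemma F_space_deriv: "t \<ge> 0 \<Longrightarrow> (F t has_derivative (\<lambda>h. DF (t, x) (0, h))) (at x)"
  using has_derivative_partial_space[OF F_deriv[of "(t, x)"]] by simp

lemma J_deriv: "(F 0 has_derivative (\<lambda>h. J *v h)) (at (y 0))"
  using differentiableI[OF F_space_deriv[OF order_refl]] unfolding jacobian_works .

lemma DF_space: "DF (0, y 0) (0, h) = J *v h"
  using has_derivative_unique[OF J_deriv F_space_deriv[of 0 "y 0"]] by (simp add: fun_eq_iff)

text \<open>The vanishing time derivative of the constraints enters here: to first order, they see
  only the spatial direction.\<close>

lemma DF_direction: "DF (0, y 0) (1, h) = J *v h"
  using blinfun.add_right[of "DF (0, y 0)" "(1, 0)" "(0, h)"] by (simp add: DF_time DF_space)

lemma inner_transpose_J: "inner (transpose J *v w) h = inner w (J *v h)"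
  by (simp add: dot_lmul_matrix)

lemma normal_cone_iff:
  "w \<in> normal_cone nonpos_orthant (F 0 (y 0)) \<longleftrightarrow> (\<forall>i. w $ i \<ge> 0) \<and> (\<forall>i. i \<notin> active \<longrightarrow> w $ i = 0)"
  by (auto simp: mem_normal_cone_nonpos_orthant[OF F0_orthant] active_def)

lemma mem_Y_iff:
  "w \<in> Y \<longleftrightarrow> (\<forall>i. w $ i \<ge> 0) \<and> (\<forall>i. i \<notin> active \<longrightarrow> w $ i = 0) \<and> transpose J *v w = v"
  by (simp only: Y_set_def mem_Collect_eq normal_cone_iff conj_assoc)

lemma mem_K_iff: "x \<in> K \<longleftrightarrow> (\<forall>i\<in>active. (J *v x) $ i \<le> 0) \<and> inner v x = 0"
  by (auto simp: K_set_def mem_tangent_cone_nonpos_orthant[OF F0_orthant] active_def inner_commute)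

lemma inner_Y: "w \<in> Y \<Longrightarrow> inner v h = inner w (J *v h)"
  using inner_transpose_J[of w h] by (simp only: mem_Y_iff)

lemma Y_complementary: "w \<in> Y \<Longrightarrow> inner w (F 0 (y 0)) = 0"
  by (auto simp: mem_Y_iff active_def inner_vec_def intro!: sum.neutral)

section \<open>Multipliers and linear programming duality\<close>

lemma qualification_scaled:
  assumes "w \<in> normal_cone nonpos_orthant (F 0 (y 0))"
  shows "c * norm w \<le> norm (transpose J *v w)"
proof (cases "w = 0")
  case False
  define w' where "w' = (1 / norm w) *\<^sub>R w"
  have "w' \<in> normal_cone nonpos_orthant (F 0 (y 0))"
    using assms by (auto simp: normal_cone_iff w'_def)
  moreover have "norm w' = 1" using False by (simp add: w'_def)
  ultimately have "c \<le> norm (transpose J *v w')" by (rule qualification)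
  also have "transpose J *v w' = (1 / norm w) *\<^sub>R (transpose J *v w)"
    unfolding w'_def by (rule matrix_vector_mult_scaleR)
  finally show ?thesis using False by (simp add: field_simps del: transpose_matrix_vector)
qed simp

text \<open>Normalised form of the alternative, with cost vector \<open>- v\<close>: the multiplier
  of the cost is positive by the qualification and is scaled to 1.\<close>

lemma multiplier_alternative:
  assumes "\<nexists>\<xi>. (\<forall>i\<in>active. (J *v \<xi>) $ i + u $ i < 0) \<and> inner (- v) \<xi> < \<beta>"
  obtains w where "w \<in> Y" "inner w u \<ge> \<beta>"
proof -
  obtain w l where w: "w \<noteq> 0 \<or> l \<noteq> 0" "l \<ge> 0" "\<And>i. w $ i \<ge> 0" "\<And>i. i \<notin> active \<Longrightarrow> w $ i = 0"
    "transpose J *v w + l *\<^sub>R (- v) = 0" "l * \<beta> \<le> inner w u"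
    using strict_system_alternative[OF assms] by metis
  have eq: "transpose J *v w = l *\<^sub>R v" using w(5) by (simp add: eq_neg_iff_add_eq_0)
  have "w \<in> normal_cone nonpos_orthant (F 0 (y 0))" using w by (simp add: normal_cone_iff)
  then have "c * norm w \<le> norm (l *\<^sub>R v)" using qualification_scaled eq by metis
  \<comment> \<open>If \<open>l\<close> were zero, the qualification would force \<open>w\<close> to
    vanish as well.\<close>
  then have "l \<noteq> 0" using w(1) c_pos by (auto simp: mult_le_0_iff)
  then have l: "l > 0" using w(2) by simp
  have "transpose J *v ((1 / l) *\<^sub>R w) = v"
    using l by (simp only: matrix_vector_mult_scaleR eq) simp
  then have "(1 / l) *\<^sub>R w \<in> Y" using w l by (simp add: mem_Y_iff del: transpose_matrix_vector)
  moreover have "inner ((1 / l) *\<^sub>R w) u \<ge> \<beta>" using w(6) l by (simp add: field_simps)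
  ultimately show thesis by (rule that)
qed

text \<open>Karush-Kuhn-Tucker conditions at time 0: a direction of strict decrease for all active
  constraints and for the objective would lead to a better feasible point.\<close>

lemma Y_nonempty: "Y \<noteq> {}"
proof -
  have "\<nexists>\<xi>. (\<forall>i\<in>active. (J *v \<xi>) $ i + 0 $ i < 0) \<and> inner (- v) \<xi> < 0"
  proof
    assume "\<exists>\<xi>. (\<forall>i\<in>active. (J *v \<xi>) $ i + 0 $ i < 0) \<and> inner (- v) \<xi> < 0"
    then obtain \<xi> where \<xi>: "\<And>i. i \<in> active \<Longrightarrow> (J *v \<xi>) $ i < 0" "inner (G 0 (y 0)) \<xi> < 0" by auto
    have line: "((\<lambda>s. y 0 + s *\<^sub>R \<xi>) has_derivative (\<lambda>s. s *\<^sub>R \<xi>)) (at 0)"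
      by (auto intro!: derivative_eq_intros)
    have F_line: "((\<lambda>s. F 0 (y 0 + s *\<^sub>R \<xi>) $ i) has_real_derivative (J *v \<xi>) $ i) (at 0)" for i
    proof (rule has_derivative_imp_has_field_derivative)
      show "((\<lambda>s. F 0 (y 0 + s *\<^sub>R \<xi>) $ i) has_derivative (\<lambda>s. (J *v (s *\<^sub>R \<xi>)) $ i)) (at 0)"
        using has_derivative_compose[OF line, of "F 0"] J_deriv
        by (intro bounded_linear.has_derivative[OF bounded_linear_vec_nth]) simp
    qed (simp add: matrix_vector_mult_scaleR)
    have g_line: "((\<lambda>s. g 0 (y 0 + s *\<^sub>R \<xi>)) has_real_derivative inner (G 0 (y 0)) \<xi>) (at 0)"
    proof (rule has_derivative_imp_has_field_derivative)
      show "((\<lambda>s. g 0 (y 0 + s *\<^sub>R \<xi>)) has_derivative (\<lambda>s. inner (s *\<^sub>R \<xi>) (G 0 (y 0)))) (at 0)"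
        using has_derivative_compose[OF line, of "g 0" "\<lambda>h. inner h (G 0 (y 0))"] g_grad[of 0 "y 0"] by (simp add: gderiv_def)
    qed (simp add: inner_commute)
    have "eventually (\<lambda>s. \<forall>i. F 0 (y 0 + s *\<^sub>R \<xi>) $ i \<le> 0) (at_right 0)"
    proof (rule eventually_all_finite)
      fix i
      show "eventually (\<lambda>s. F 0 (y 0 + s *\<^sub>R \<xi>) $ i \<le> 0) (at_right 0)"
      proof (cases "i \<in> active")
        case True
        then have "eventually (\<lambda>s. F 0 (y 0 + s *\<^sub>R \<xi>) $ i < 0) (at_right 0)"
          using eventually_below_if_deriv_neg[OF F_line[of i] \<xi>(1)] by (simp add: active_def)
        then show ?thesis by (rule eventually_mono) simp
      next
        case False
        then have "F 0 (y 0) $ i < 0" using F_le_0(1)[of 0 i] by (simp add: active_def)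
        moreover have "((\<lambda>s. F 0 (y 0 + s *\<^sub>R \<xi>) $ i) \<longlongrightarrow> F 0 (y 0 + 0 *\<^sub>R \<xi>) $ i) (at 0 within {0<..})"
          using DERIV_isCont[OF F_line[of i]] unfolding isCont_def by (rule tendsto_within_subset) simp
        ultimately have "eventually (\<lambda>s. F 0 (y 0 + s *\<^sub>R \<xi>) $ i < 0) (at_right 0)"
          by (auto dest: order_tendstoD(2))
        then show ?thesis by (rule eventually_mono) simp
      qed
    qed
    moreover have "eventually (\<lambda>s. g 0 (y 0 + (0 + s) *\<^sub>R \<xi>) < g 0 (y 0 + 0 *\<^sub>R \<xi>)) (at_right 0)"
      using \<xi>(2) by (rule eventually_below_if_deriv_neg[OF g_line])
    ultimately have "eventually (\<lambda>s::real. False) (at_right 0)"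
    proof eventually_elim
      case (elim s)
      then show ?case using y_optimal[of 0 "y 0 + s *\<^sub>R \<xi>"] by simp
    qed
    then show False by simp
  qed
  then show ?thesis by (rule multiplier_alternative) auto
qed

text \<open>The qualification bounds every multiplier by \<open>norm v / c\<close>, and some
  multiplier exists.\<close>

lemma support_fun_real: "support_fun Y u = ereal (\<sigma> u)"
proof -
  obtain w where w: "w \<in> Y" using Y_nonempty by blast
  have "support_fun Y u \<le> ereal (norm v / c * norm u)"
    unfolding support_fun_def
  proof (rule SUP_least)
    fix w assume w: "w \<in> Y"
    then have "w \<in> normal_cone nonpos_orthant (F 0 (y 0))" "transpose J *v w = v"
      unfolding mem_Y_iff normal_cone_iff by blast+
    then have "c * norm w \<le> norm v" using qualification_scaled by metis
    then have "norm w \<le> norm v / c" using c_pos by (simp add: field_simps)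
    then have "norm w * norm u \<le> norm v / c * norm u" by (rule mult_right_mono) simp
    then show "ereal (inner w u) \<le> ereal (norm v / c * norm u)"
      using norm_cauchy_schwarz[of w u] by simp
  qed
  moreover have "ereal (inner w u) \<le> support_fun Y u"
    unfolding support_fun_def by (rule SUP_upper[OF w])
  ultimately have "\<bar>support_fun Y u\<bar> \<noteq> \<infinity>" by (cases "support_fun Y u") auto
  then show ?thesis by (simp add: \<sigma>_def ereal_real)
qed

lemma support_upper: "w \<in> Y \<Longrightarrow> inner w u \<le> \<sigma> u"
  using SUP_upper[of w Y "\<lambda>w. ereal (inner w u)"] support_fun_real[of u] by (simp add: support_fun_def)

lemma support_least: "(\<And>w. w \<in> Y \<Longrightarrow> inner w u \<le> M) \<Longrightarrow> \<sigma> u \<le> M"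
  using SUP_least[of Y "\<lambda>w. ereal (inner w u)" "ereal M"] support_fun_real[of u] by (simp add: support_fun_def)

text \<open>Strong duality: maximising over \<open>Y\<close> is dual to minimising
  \<open>inner (- v) \<xi>\<close> under the linearised active constraints. The margin \<delta>
  makes room for strict inequalities.\<close>

lemma support_dual:
  assumes "\<delta> > 0"
  obtains \<xi> where "\<And>i. i \<in> active \<Longrightarrow> (J *v \<xi>) $ i + u $ i < 0" "inner (- v) \<xi> < \<sigma> u + \<delta>"
proof (rule ccontr)
  assume "\<not> thesis"
  then have "\<nexists>\<xi>. (\<forall>i\<in>active. (J *v \<xi>) $ i + u $ i < 0) \<and> inner (- v) \<xi> < \<sigma> u + \<delta>" using that by blast
  then obtain w where "w \<in> Y" "inner w u \<ge> \<sigma> u + \<delta>" by (rule multiplier_alternative)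
  then show False using support_upper[of w u] assms by simp
qed

section \<open>Expansions and convexity of the limit problem\<close>

text \<open>Second-order expansion on the half-space along \<open>(1, x n)\<close>, with the linear
  term simplified by \<open>DF_direction\<close>.\<close>

lemma F_expansion:
  assumes t: "t \<longlonglongrightarrow> 0" "\<And>n. t n > 0" and x: "x \<longlonglongrightarrow> x0"
  shows "(\<lambda>n. (1 / (t n)\<^sup>2) *\<^sub>R (F (t n) (y 0 + t n *\<^sub>R x n) - F 0 (y 0) - t n *\<^sub>R (J *v x n))) \<longlonglongrightarrow> U x0"
proof -
  have "(\<lambda>n. (1 / (t n)\<^sup>2) *\<^sub>R ((\<lambda>(t, x). F t x) ((0, y 0) + t n *\<^sub>R (1, x n)) - (\<lambda>(t, x). F t x) (0, y 0)
      - t n *\<^sub>R DF (0, y 0) (1, x n))) \<longlonglongrightarrow> (1/2) *\<^sub>R D2F (1, x0) (1, x0)"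
  proof (rule second_order_expansion[where S = half_space])
    show "convex (half_space :: (real \<times> (real ^ 'm)) set)" by (intro convex_Times) auto
    show "(0, y 0) + t n *\<^sub>R (1, x n) \<in> half_space" for n using t(2)[of n] by simp
  qed (use F_deriv DF_deriv t in \<open>auto intro!: tendsto_intros x\<close>)
  then show ?thesis by (simp add: DF_direction U_def)
qed

lemma g_expansion:
  assumes t: "t \<longlonglongrightarrow> 0" "\<And>n. t n > 0" and x: "x \<longlonglongrightarrow> x0"
  shows "(\<lambda>n. (1 / (t n)\<^sup>2) * (g (t n) (y 0 + t n *\<^sub>R x n) - g (t n) (y 0) + t n * inner v (x n))) \<longlonglongrightarrow> q x0"
  using partial_gradient_expansion[OF g_grad G_deriv t x] by (simp add: q_def)

text \<open>The second-order quotients in \<open>F_expansion\<close> are convex in \<open>x\<close>, hence so is their limit.\<close>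

lemma U_midpoint:
  assumes "i \<in> active"
  shows "U ((1/2) *\<^sub>R x1 + (1/2) *\<^sub>R x2) $ i \<le> 1/2 * U x1 $ i + 1/2 * U x2 $ i"
proof -
  define t where "t = (\<lambda>n. 1 / real (Suc n))"
  define m where "m = (1/2) *\<^sub>R x1 + (1/2) *\<^sub>R x2"
  have t: "t \<longlonglongrightarrow> 0" "\<And>n. t n > 0" unfolding t_def by (rule LIMSEQ_Suc[OF lim_1_over_n]) auto
  \<comment> \<open>The constant term is absent because constraint \<open>i\<close> is active; the
    term in \<open>J\<close> is linear in \<open>x\<close> and preserves convexity.\<close>
  define E where "E = (\<lambda>x n. (1 / (t n)\<^sup>2) * (F (t n) (y 0 + t n *\<^sub>R x) $ i - t n * (J *v x) $ i))"
  have lim: "E x \<longlonglongrightarrow> U x $ i" for x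
    using tendsto_vec_nth[OF F_expansion[OF t tendsto_const[of x]], of i] assms
    by (simp add: E_def active_def)
  have "E m n \<le> 1/2 * E x1 n + 1/2 * E x2 n" for n
  proof -
    have m: "y 0 + t n *\<^sub>R m = (1/2) *\<^sub>R (y 0 + t n *\<^sub>R x1) + (1/2) *\<^sub>R (y 0 + t n *\<^sub>R x2)"
      by (simp add: m_def vec_eq_iff field_simps)
    have "F (t n) (y 0 + t n *\<^sub>R m) $ i
        \<le> 1/2 * F (t n) (y 0 + t n *\<^sub>R x1) $ i + 1/2 * F (t n) (y 0 + t n *\<^sub>R x2) $ i"
      unfolding m
      using convex_onD[OF F_convex[of "t n" i], of "1/2" "y 0 + t n *\<^sub>R x1" "y 0 + t n *\<^sub>R x2"] t(2)[of n]
      by simp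
    moreover have "(J *v m) $ i = 1/2 * (J *v x1) $ i + 1/2 * (J *v x2) $ i"
      by (simp add: m_def matrix_vector_right_distrib matrix_vector_mult_scaleR)
    ultimately have "F (t n) (y 0 + t n *\<^sub>R m) $ i - t n * (J *v m) $ i
       \<le> 1/2 * (F (t n) (y 0 + t n *\<^sub>R x1) $ i - t n * (J *v x1) $ i)
         + 1/2 * (F (t n) (y 0 + t n *\<^sub>R x2) $ i - t n * (J *v x2) $ i)"
      by (simp add: algebra_simps)
    from mult_left_mono[OF this, of "1 / (t n)\<^sup>2"] show ?thesis
      by (simp add: E_def algebra_simps)
  qed
  then show ?thesis unfolding m_def[symmetric]
    by (intro LIMSEQ_le[OF lim tendsto_add[OF tendsto_mult_left[OF lim] tendsto_mult_left[OF lim]]]) auto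
qed

text \<open>Multipliers are nonnegative and vanish off \<open>active\<close>, where alone convexity
  of \<open>U\<close> is at hand; the supremum over them inherits convexity.\<close>

lemma support_midpoint:
  "\<sigma> (U ((1/2) *\<^sub>R x1 + (1/2) *\<^sub>R x2)) \<le> 1/2 * \<sigma> (U x1) + 1/2 * \<sigma> (U x2)"
proof (rule support_least)
  fix w assume w: "w \<in> Y"
  have "inner w (U ((1/2) *\<^sub>R x1 + (1/2) *\<^sub>R x2)) \<le> inner w ((1/2) *\<^sub>R U x1 + (1/2) *\<^sub>R U x2)"
    unfolding inner_vec_def
  proof (rule sum_mono)
    fix i
    show "inner (w $ i) (U ((1/2) *\<^sub>R x1 + (1/2) *\<^sub>R x2) $ i) \<le> inner (w $ i) (((1/2) *\<^sub>R U x1 + (1/2) *\<^sub>R U x2) $ i)"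
    proof (cases "i \<in> active")
      case True
      then show ?thesis using U_midpoint[OF True, of x1 x2] w
        by (auto simp: mem_Y_iff intro!: mult_left_mono)
    next
      case False
      then have "w $ i = 0" using w unfolding mem_Y_iff by blast
      then show ?thesis by simp
    qed
  qed
  also have "\<dots> \<le> 1/2 * \<sigma> (U x1) + 1/2 * \<sigma> (U x2)"
    using support_upper[OF w, of "U x1"] support_upper[OF w, of "U x2"] by (simp add: inner_add_right)
  finally show "inner w (U ((1/2) *\<^sub>R x1 + (1/2) *\<^sub>R x2)) \<le> 1/2 * \<sigma> (U x1) + 1/2 * \<sigma> (U x2)" .
qed

lemma H_linear: "linear H"
proof -
  have "bounded_linear (\<lambda>h. (\<lambda>(\<tau>, h). \<tau> *\<^sub>R b + H h) (0, h))"
    by (rule bounded_linear_compose[OF has_derivative_bounded_linear[OF G_deriv]])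
      (intro bounded_linear_intros)
  then show ?thesis by (simp add: bounded_linear.linear)
qed

text \<open>Strong monotonicity of \<open>G 0\<close> between \<open>y 0\<close> and nearby points,
  divided by the squared step, passes to the limit.\<close>

lemma H_coercive: "inner (H h) h \<ge> \<alpha> * (norm h)\<^sup>2"
proof -
  define t where "t = (\<lambda>n. 1 / real (Suc n))"
  have t: "t \<longlonglongrightarrow> 0" "\<And>n. t n > 0" unfolding t_def by (rule LIMSEQ_Suc[OF lim_1_over_n]) auto
  have "(\<lambda>n. (1 / t n) *\<^sub>R ((\<lambda>(t, x). G t x) ((0, y 0) + t n *\<^sub>R (0, h)) - (\<lambda>(t, x). G t x) (0, y 0)))
      \<longlonglongrightarrow> (\<lambda>(\<tau>, h). \<tau> *\<^sub>R b + H h) (0, h)"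
    by (rule directional_difference_quotient[OF G_deriv t]) auto
  then have "(\<lambda>n. (1 / t n) *\<^sub>R (G 0 (y 0 + t n *\<^sub>R h) - G 0 (y 0))) \<longlonglongrightarrow> H h" by simp
  then have "(\<lambda>n. inner ((1 / t n) *\<^sub>R (G 0 (y 0 + t n *\<^sub>R h) - G 0 (y 0))) h) \<longlonglongrightarrow> inner (H h) h"
    by (intro tendsto_inner tendsto_const)
  moreover have "\<alpha> * (norm h)\<^sup>2 \<le> inner ((1 / t n) *\<^sub>R (G 0 (y 0 + t n *\<^sub>R h) - G 0 (y 0))) h" for n
  proof -
    have "\<alpha> * (norm (t n *\<^sub>R h))\<^sup>2 \<le> inner (G 0 (y 0 + t n *\<^sub>R h) - G 0 (y 0)) (t n *\<^sub>R h)"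
      using G_mono[of 0, unfolded strongly_monotone_with_def, simplified, rule_format,
        where ?x1.0 = "y 0" and ?x2.0 = "y 0 + t n *\<^sub>R h"] by simp
    then have "t n * (\<alpha> * (norm h)\<^sup>2 * t n) \<le> t n * inner (G 0 (y 0 + t n *\<^sub>R h) - G 0 (y 0)) h"
      by (simp add: power_mult_distrib power2_eq_square mult_ac)
    then have "\<alpha> * (norm h)\<^sup>2 * t n \<le> inner (G 0 (y 0 + t n *\<^sub>R h) - G 0 (y 0)) h"
      using t(2)[of n] by simp
    then show ?thesis using t(2)[of n] by (simp add: pos_le_divide_eq)
  qed
  ultimately show ?thesis by (intro LIMSEQ_le_const) auto
qed

lemma minimizer_unique:
  assumes K: "x1 \<in> K" "x2 \<in> K"
    and min1: "\<And>x. x \<in> K \<Longrightarrow> q x1 + \<sigma> (U x1) \<le> q x + \<sigma> (U x)"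
    and min2: "\<And>x. x \<in> K \<Longrightarrow> q x2 + \<sigma> (U x2) \<le> q x + \<sigma> (U x)"
  shows "x1 = x2"
proof -
  define m where "m = (1/2) *\<^sub>R x1 + (1/2) *\<^sub>R x2"
  have "m \<in> K"
    using K by (auto simp: mem_K_iff m_def matrix_vector_right_distrib matrix_vector_mult_scaleR inner_add_right
        intro: add_nonpos_nonpos)
  then have le: "q x1 + \<sigma> (U x1) \<le> q m + \<sigma> (U m)" "q x2 + \<sigma> (U x2) \<le> q m + \<sigma> (U m)"
    using min1 min2 by auto
  have "\<sigma> (U m) \<le> 1/2 * \<sigma> (U x1) + 1/2 * \<sigma> (U x2)" unfolding m_def by (rule support_midpoint)
  \<comment> \<open>The expansion keeps both mixed terms and so holds for a possibly nonsymmetric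
    \<open>H\<close>; the deficit is the strict convexity gain.\<close>
  moreover have "q m = 1/2 * q x1 + 1/2 * q x2 - 1/8 * inner (H (x1 - x2)) (x1 - x2)"
    unfolding q_def m_def
    by (simp add: linear_add[OF H_linear] linear_diff[OF H_linear] linear_scale[OF H_linear]
        inner_add_left inner_add_right inner_diff_left inner_diff_right algebra_simps)
  ultimately have "inner (H (x1 - x2)) (x1 - x2) \<le> 0" using le by simp
  with H_coercive[of "x1 - x2"] have "\<alpha> * (norm (x1 - x2))\<^sup>2 \<le> 0" by linarith
  then show ?thesis using \<alpha>_pos by (simp add: mult_le_0_iff)
qed

section \<open>Boundedness of the difference quotients\<close>

text \<open>Strong convexity bounds \<open>\<alpha> / 2 * (norm h)\<^sup>2\<close> by a linear term
  in \<open>h\<close>. Its part \<open>inner v h\<close> is controlled through a multiplier and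
  convexity of the constraints, leaving only terms of order s times \<open>norm h\<close> and of
  order s squared.\<close>

lemma quotient_bounded:
  assumes t: "t \<longlonglongrightarrow> 0" "\<And>n. t n > 0"
  shows "bounded (range (\<lambda>n. (1 / t n) *\<^sub>R (y (t n) - y 0)))"
proof -
  obtain w where w: "w \<in> Y" using Y_nonempty by blast
  have "(\<lambda>n. (1 / t n) *\<^sub>R ((\<lambda>(t, x). G t x) ((0, y 0) + t n *\<^sub>R (1, 0)) - (\<lambda>(t, x). G t x) (0, y 0)))
      \<longlonglongrightarrow> (\<lambda>(\<tau>, h). \<tau> *\<^sub>R b + H h) (1, 0)"
    using t(2) by (intro directional_difference_quotient[OF G_deriv t]) (auto simp: less_imp_le)
  then have "(\<lambda>n. (1 / t n) *\<^sub>R (G (t n) (y 0) - G 0 (y 0))) \<longlonglongrightarrow> b + H 0" by simp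
  then obtain B1 where B1: "B1 > 0" "\<And>n. norm ((1 / t n) *\<^sub>R (G (t n) (y 0) - G 0 (y 0))) \<le> B1"
    by (rule LIMSEQ_norm_bounded) blast
  have "(\<lambda>n. (1 / t n) *\<^sub>R (DF ((0, y 0) + t n *\<^sub>R (1, 0)) - DF (0, y 0))) \<longlonglongrightarrow> D2F (1, 0)"
    using t(2) by (intro directional_difference_quotient[OF DF_deriv t]) (auto simp: less_imp_le)
  then have "(\<lambda>n. (1 / t n) *\<^sub>R (DF (t n, y 0) - DF (0, y 0))) \<longlonglongrightarrow> D2F (1, 0)" by simp
  then obtain B2 where B2: "B2 > 0" "\<And>n. norm ((1 / t n) *\<^sub>R (DF (t n, y 0) - DF (0, y 0))) \<le> B2"
    by (rule LIMSEQ_norm_bounded) blast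
  have "(\<lambda>n. (1 / (t n)\<^sup>2) *\<^sub>R (F (t n) (y 0) - F 0 (y 0))) \<longlonglongrightarrow> U 0"
    using F_expansion[OF t tendsto_const[of 0]] by simp
  then obtain B3 where B3: "B3 > 0" "\<And>n. norm ((1 / (t n)\<^sup>2) *\<^sub>R (F (t n) (y 0) - F 0 (y 0))) \<le> B3"
    by (rule LIMSEQ_norm_bounded) blast
  define P where "P = B1 + norm w * B2 + norm w * B3"
  have "norm ((1 / t n) *\<^sub>R (y (t n) - y 0)) \<le> max 1 (2 * P / \<alpha>)" for n
  proof -
    define s where "s = t n"
    have s: "s > 0" using t(2) by (simp add: s_def)
    define h where "h = y s - y 0"
    define r where "r = norm h / s"
    have r: "norm h = s * r" "r \<ge> 0" using s by (auto simp: r_def)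
    have b1: "norm (G s (y 0) - G 0 (y 0)) \<le> B1 * s" using norm_le_if_scaled[OF B1(2)[of n]] s by (simp add: s_def)
    have b2: "norm (DF (s, y 0) - DF (0, y 0)) \<le> B2 * s" using norm_le_if_scaled[OF B2(2)[of n]] s by (simp add: s_def)
    have b3: "norm (F s (y 0) - F 0 (y 0)) \<le> B3 * s\<^sup>2" using norm_le_if_scaled[OF B3(2)[of n]] s by (simp add: s_def)
    have "g s (y s) \<le> g s (y 0)" using s F_le_0(2) by (intro y_optimal) auto
    moreover have "g s (y s) \<ge> g s (y 0) + inner (G s (y 0)) h + \<alpha> / 2 * (norm h)\<^sup>2"
      using s unfolding h_def by (intro strongly_convex_lower_bound g_grad G_mono) auto
    moreover have "- inner (G s (y 0)) h = inner v h - inner (G s (y 0) - G 0 (y 0)) h"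
      by (simp add: inner_diff_left)
    moreover have "- inner (G s (y 0) - G 0 (y 0)) h \<le> B1 * s * norm h"
      using Cauchy_Schwarz_ineq2[of "G s (y 0) - G 0 (y 0)" h] mult_right_mono[OF b1, of "norm h"] by simp
    moreover have "inner v h \<le> norm w * (B3 * s\<^sup>2) + norm w * (B2 * s * norm h)"
    proof -
      \<comment> \<open>The derivative at time 0 is traded for the one at time s, where convexity of
        \<open>F s\<close> compares \<open>y 0\<close> with the feasible point
        \<open>y s\<close>.\<close>
      have "inner v h = inner w (DF (s, y 0) (0, h)) - inner w ((DF (s, y 0) - DF (0, y 0)) (0, h))"
        by (simp only: inner_Y[OF w] DF_space blinfun.diff_left inner_diff_right)
      moreover have "inner w (DF (s, y 0) (0, h)) \<le> - inner w (F s (y 0))"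
      proof -
        have "inner w (DF (s, y 0) (0, h)) \<le> inner w (- F s (y 0))"
          unfolding inner_vec_def
        proof (rule sum_mono)
          fix i
          have "((\<lambda>x. F s x $ i) has_derivative (\<lambda>h. DF (s, y 0) (0, h) $ i)) (at (y 0))"
            using s by (intro bounded_linear.has_derivative[OF bounded_linear_vec_nth] F_space_deriv) simp
          then have "F s (y 0) $ i + DF (s, y 0) (0, h) $ i \<le> F s (y 0 + h) $ i"
            using s by (intro convex_on_gradient_inequality[where f = "\<lambda>x. F s x $ i"] F_convex) auto
          also have "\<dots> \<le> 0" using F_le_0(1)[of s i] s by (simp add: h_def)
          finally have "DF (s, y 0) (0, h) $ i \<le> (- F s (y 0)) $ i" by simp
          moreover have "w $ i \<ge> 0" using w unfolding mem_Y_iff by blast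
          ultimately show "inner (w $ i) (DF (s, y 0) (0, h) $ i) \<le> inner (w $ i) ((- F s (y 0)) $ i)"
            unfolding inner_real_def by (rule mult_left_mono)
        qed
        then show ?thesis by simp
      qed
      \<comment> \<open>Complementarity inserts \<open>F 0 (y 0)\<close>, so that the quadratic
        bound with \<open>B3\<close>, owed to the vanishing time derivative, applies.\<close>
      moreover have "- inner w (F s (y 0)) = - inner w (F s (y 0) - F 0 (y 0))"
        by (simp add: inner_diff_right Y_complementary[OF w])
      moreover have "- inner w (F s (y 0) - F 0 (y 0)) \<le> norm w * (B3 * s\<^sup>2)"
        using Cauchy_Schwarz_ineq2[of w "F s (y 0) - F 0 (y 0)"] mult_left_mono[OF b3, of "norm w"] by simp
      moreover have "- inner w ((DF (s, y 0) - DF (0, y 0)) (0, h)) \<le> norm w * (B2 * s * norm h)"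
      proof -
        have "norm ((DF (s, y 0) - DF (0, y 0)) (0, h)) \<le> B2 * s * norm h"
          using norm_blinfun[of "DF (s, y 0) - DF (0, y 0)" "(0, h)"] mult_right_mono[OF b2, of "norm h"]
          by (simp add: norm_Pair)
        then have "norm w * norm ((DF (s, y 0) - DF (0, y 0)) (0, h)) \<le> norm w * (B2 * s * norm h)"
          by (rule mult_left_mono) simp
        then show ?thesis
          using Cauchy_Schwarz_ineq2[of w "(DF (s, y 0) - DF (0, y 0)) (0, h)"] by linarith
      qed
      ultimately show ?thesis by linarith
    qed
    ultimately have "\<alpha> / 2 * (norm h)\<^sup>2 \<le> B1 * s * norm h + (norm w * (B3 * s\<^sup>2) + norm w * (B2 * s * norm h))"
      by linarith
    then have "s\<^sup>2 * (\<alpha> / 2 * r\<^sup>2) \<le> s\<^sup>2 * (B1 * r + norm w * B3 + norm w * B2 * r)"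
      unfolding r(1) by (simp add: power2_eq_square algebra_simps)
    then have le: "\<alpha> / 2 * r\<^sup>2 \<le> B1 * r + norm w * B3 + norm w * B2 * r" using s by simp
    \<comment> \<open>For \<open>r > 1\<close> the constant term is absorbed into a multiple of r,
      and one factor r cancels.\<close>
    have "r \<le> max 1 (2 * P / \<alpha>)"
    proof (cases "r \<le> 1")
      case False
      have "norm w * B3 * 1 \<le> norm w * B3 * r" using False B3(1) by (intro mult_left_mono) auto
      with le have "r * (\<alpha> / 2 * r) \<le> r * P" by (simp add: P_def power2_eq_square algebra_simps)
      then have "\<alpha> / 2 * r \<le> P" using False by simp
      then show ?thesis using \<alpha>_pos by (simp add: field_simps max.coboundedI2)
    qed simp
    then show ?thesis using s by (simp add: r_def h_def s_def)
  qed
  then show ?thesis by (intro boundedI) auto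
qed

section \<open>Cluster points solve the limit problem\<close>

text \<open>Membership in \<open>K\<close> follows from the relations of order \<open>t n\<close>;
  minimality follows at order \<open>(t n)\<^sup>2\<close> by comparison with feasible arcs.\<close>

lemma cluster_point_minimizer:
  assumes t: "t \<longlonglongrightarrow> 0" "\<And>n. t n > 0"
    and x: "(\<lambda>n. (1 / t n) *\<^sub>R (y (t n) - y 0)) \<longlonglongrightarrow> x0"
  shows "x0 \<in> K" "\<And>x. x \<in> K \<Longrightarrow> q x0 + \<sigma> (U x0) \<le> q x + \<sigma> (U x)"
proof -
  define X where "X = (\<lambda>n. (1 / t n) *\<^sub>R (y (t n) - y 0))"
  have X: "X \<longlonglongrightarrow> x0" using x by (simp add: X_def)
  have yX: "y 0 + t n *\<^sub>R X n = y (t n)" for n using t(2)[of n] by (simp add: X_def)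
  \<comment> \<open>\<open>E\<close> here and \<open>e\<close> below are the rescaled remainders of
    constraints and objective. The objective keeps \<open>inner v (X n)\<close> at order
    \<open>t n\<close>, the source of the singular term.\<close>
  define E where "E = (\<lambda>n. (1 / (t n)\<^sup>2) *\<^sub>R (F (t n) (y (t n)) - F 0 (y 0) - t n *\<^sub>R (J *v X n)))"
  have E: "E \<longlonglongrightarrow> U x0" using F_expansion[OF t X] by (simp add: E_def yX)
  define e where "e = (\<lambda>n. (1 / (t n)\<^sup>2) * (g (t n) (y (t n)) - g (t n) (y 0) + t n * inner v (X n)))"
  have e: "e \<longlonglongrightarrow> q x0" using g_expansion[OF t X] by (simp only: e_def yX)
  have F_eq: "F (t n) (y (t n)) = F 0 (y 0) + t n *\<^sub>R (J *v X n) + (t n)\<^sup>2 *\<^sub>R E n" for n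
    using t(2)[of n] by (simp add: E_def)
  have g_eq: "g (t n) (y (t n)) - g (t n) (y 0) = (t n)\<^sup>2 * e n - t n * inner v (X n)" for n
    using t(2)[of n] by (simp add: e_def)
  \<comment> \<open>The constraints at \<open>y (t n)\<close> are tested against \<open>w\<close>:
    the constant term vanishes by complementarity, and \<open>w\<close> turns the term in
    \<open>J\<close> into \<open>inner v (X n)\<close>.\<close>
  have multiplier_le: "inner v (X n) + t n * inner w (E n) \<le> 0" if w: "w \<in> Y" for w n
  proof -
    have "inner w (F (t n) (y (t n))) \<le> 0"
      unfolding inner_vec_def using w F_le_0(1)[of "t n"] t(2)[of n]
      by (intro sum_nonpos) (auto simp: mem_Y_iff mult_nonneg_nonpos)
    then have "t n * (inner v (X n) + t n * inner w (E n)) \<le> 0"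
      by (simp only: F_eq inner_Y[OF w] inner_add_right inner_scaleR_right Y_complementary[OF w])
        (simp add: power2_eq_square algebra_simps)
    then show ?thesis using t(2)[of n] by (simp add: mult_le_0_iff)
  qed
  obtain w0 where w0: "w0 \<in> Y" using Y_nonempty by blast
  show "x0 \<in> K"
    unfolding mem_K_iff
  proof (intro conjI ballI antisym)
    fix i assume i: "i \<in> active"
    have "(J *v X n) $ i + t n * E n $ i \<le> 0" for n
    proof -
      have "t n * ((J *v X n) $ i + t n * E n $ i) \<le> 0"
        using F_le_0(1)[of "t n" i] t(2)[of n] i
        by (simp add: F_eq active_def power2_eq_square algebra_simps)
      then show ?thesis using t(2)[of n] by (simp add: mult_le_0_iff)
    qed
    moreover have "(\<lambda>n. (J *v X n) $ i + t n * E n $ i) \<longlonglongrightarrow> (J *v x0) $ i + 0 * U x0 $ i"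
      by (intro tendsto_intros t E X tendsto_vec_nth
          bounded_linear.tendsto[OF matrix_vector_mul_bounded_linear])
    ultimately show "(J *v x0) $ i \<le> 0" by (auto intro: LIMSEQ_le_const2)
  next
    have "(\<lambda>n. inner v (X n) + t n * inner w0 (E n)) \<longlonglongrightarrow> inner v x0 + 0 * inner w0 (U x0)"
      by (intro tendsto_intros t E X)
    then show "inner v x0 \<le> 0"
      using LIMSEQ_le_const2[of _ _ 0] multiplier_le[OF w0] by fastforce
    \<comment> \<open>For the reverse sign, \<open>y (t n)\<close> is compared with
      \<open>y 0\<close>, which is feasible at every time.\<close>
    have "t n * e n - inner v (X n) \<le> 0" for n
    proof -
      have "g (t n) (y (t n)) \<le> g (t n) (y 0)"
        using t(2)[of n] F_le_0(2) by (intro y_optimal) (auto simp: less_imp_le)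
      then have "t n * (t n * e n - inner v (X n)) \<le> 0"
        using g_eq[of n] by (simp add: power2_eq_square algebra_simps)
      then show ?thesis using t(2)[of n] by (simp add: mult_le_0_iff)
    qed
    moreover have "(\<lambda>n. t n * e n - inner v (X n)) \<longlonglongrightarrow> 0 * q x0 - inner v x0"
      by (intro tendsto_intros t e X)
    ultimately show "0 \<le> inner v x0"
      using LIMSEQ_le_const2[of "\<lambda>n. t n * e n - inner v (X n)" "0 * q x0 - inner v x0" 0] by auto
  qed
  fix x assume "x \<in> K"
  then have Jx: "\<And>i. i \<in> active \<Longrightarrow> (J *v x) $ i \<le> 0" and vx: "inner v x = 0" by (auto simp: mem_K_iff)
  \<comment> \<open>The support function is bounded one multiplier at a time, so that
    \<open>w\<close>, \<delta> and hence \<xi> are fixed before the limit in n.\<close>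
  have "\<sigma> (U x0) \<le> q x + \<sigma> (U x) - q x0"
  proof (rule support_least, rule field_le_epsilon)
    fix w and \<delta> :: real assume w: "w \<in> Y" and "\<delta> > 0"
    then obtain \<xi> where \<xi>: "\<And>i. i \<in> active \<Longrightarrow> (J *v \<xi>) $ i + U x $ i < 0"
      "inner (- v) \<xi> < \<sigma> (U x) + \<delta>"
      by (metis support_dual)
    \<comment> \<open>recovery sequence: the second-order correction \<open>\<xi>\<close> restores feasibility\<close>
    define Z where "Z = (\<lambda>n. x + t n *\<^sub>R \<xi>)"
    have "(\<lambda>n. x + t n *\<^sub>R \<xi>) \<longlonglongrightarrow> x + 0 *\<^sub>R \<xi>" by (intro tendsto_intros t)
    then have Z: "Z \<longlonglongrightarrow> x" by (simp add: Z_def)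
    define E' where "E' = (\<lambda>n. (1 / (t n)\<^sup>2) *\<^sub>R (F (t n) (y 0 + t n *\<^sub>R Z n) - F 0 (y 0) - t n *\<^sub>R (J *v Z n)))"
    have E': "E' \<longlonglongrightarrow> U x" using F_expansion[OF t Z] by (simp add: E'_def)
    define e' where "e' = (\<lambda>n. (1 / (t n)\<^sup>2) * (g (t n) (y 0 + t n *\<^sub>R Z n) - g (t n) (y 0) + t n * inner v (Z n)))"
    have e': "e' \<longlonglongrightarrow> q x" using g_expansion[OF t Z] by (simp only: e'_def)
    have F_eq': "F (t n) (y 0 + t n *\<^sub>R Z n) = F 0 (y 0) + t n *\<^sub>R (J *v Z n) + (t n)\<^sup>2 *\<^sub>R E' n" for n
      using t(2)[of n] by (simp add: E'_def)
    have JZ: "J *v Z n = J *v x + t n *\<^sub>R (J *v \<xi>)" for n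
      by (simp add: Z_def matrix_vector_right_distrib matrix_vector_mult_scaleR)
    \<comment> \<open>Since \<open>x\<close> is orthogonal to \<open>v\<close>, the term of order
      \<open>t n\<close> vanishes along the arc and leaves the finite contribution
      \<open>- inner v \<xi>\<close>.\<close>
    have g_eq': "g (t n) (y 0 + t n *\<^sub>R Z n) - g (t n) (y 0) = (t n)\<^sup>2 * (e' n - inner v \<xi>)" for n
    proof -
      have "inner v (Z n) = t n * inner v \<xi>" unfolding Z_def using vx by (simp add: inner_add_right)
      then have "(1 / (t n)\<^sup>2) * (g (t n) (y 0 + t n *\<^sub>R Z n) - g (t n) (y 0) + (t n)\<^sup>2 * inner v \<xi>) = e' n"
        unfolding e'_def by (simp only: power2_eq_square mult.assoc)
      then show ?thesis using t(2)[of n] by (simp add: field_simps)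
    qed
    have "eventually (\<lambda>n. \<forall>i. F (t n) (y 0 + t n *\<^sub>R Z n) $ i \<le> 0) sequentially"
    proof (rule eventually_all_finite)
      fix i
      show "eventually (\<lambda>n. F (t n) (y 0 + t n *\<^sub>R Z n) $ i \<le> 0) sequentially"
      proof (cases "i \<in> active")
        case True
        \<comment> \<open>The strict inequality satisfied by \<xi> leaves a margin that absorbs the
          error in \<open>E'\<close>.\<close>
        have "(\<lambda>n. (J *v \<xi>) $ i + E' n $ i) \<longlonglongrightarrow> (J *v \<xi>) $ i + U x $ i"
          by (intro tendsto_intros E')
        then have "eventually (\<lambda>n. (J *v \<xi>) $ i + E' n $ i < 0) sequentially"
          using \<xi>(1)[OF True] by (rule order_tendstoD(2))
        then show ?thesis
        proof (rule eventually_mono)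
          fix n assume "(J *v \<xi>) $ i + E' n $ i < 0"
          then have "(t n)\<^sup>2 * ((J *v \<xi>) $ i + E' n $ i) \<le> 0" by (simp add: mult_nonneg_nonpos)
          moreover have "t n * (J *v x) $ i \<le> 0" using Jx[OF True] t(2)[of n] by (simp add: mult_nonneg_nonpos)
          moreover have "F (t n) (y 0 + t n *\<^sub>R Z n) $ i = t n * (J *v x) $ i + (t n)\<^sup>2 * ((J *v \<xi>) $ i + E' n $ i)"
            using True by (simp add: F_eq' JZ active_def power2_eq_square algebra_simps)
          ultimately show "F (t n) (y 0 + t n *\<^sub>R Z n) $ i \<le> 0" by linarith
        qed
      next
        case False
        then have neg: "F 0 (y 0) $ i < 0" using F_le_0(1)[of 0 i] by (simp add: active_def)
        have "(\<lambda>n. F 0 (y 0) $ i + t n * (J *v Z n) $ i + (t n)\<^sup>2 * E' n $ i)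
            \<longlonglongrightarrow> F 0 (y 0) $ i + 0 * (J *v x) $ i + 0\<^sup>2 * U x $ i"
          by (intro tendsto_intros t E' Z tendsto_vec_nth
              bounded_linear.tendsto[OF matrix_vector_mul_bounded_linear])
        then have "(\<lambda>n. F (t n) (y 0 + t n *\<^sub>R Z n) $ i) \<longlonglongrightarrow> F 0 (y 0) $ i"
          by (simp add: F_eq')
        from order_tendstoD(2)[OF this neg] show ?thesis by (rule eventually_mono) simp
      qed
    qed
    \<comment> \<open>Optimality against the arc leaves the singular term at \<open>X n\<close>;
      \<open>multiplier_le\<close> bounds it below by \<open>inner w (E n)\<close>, and
      \<open>(t n)\<^sup>2\<close> cancels.\<close>
    then have "eventually (\<lambda>n. e n + inner w (E n) \<le> e' n - inner v \<xi>) sequentially"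
    proof (rule eventually_mono)
      fix n assume "\<forall>i. F (t n) (y 0 + t n *\<^sub>R Z n) $ i \<le> 0"
      then have "g (t n) (y (t n)) \<le> g (t n) (y 0 + t n *\<^sub>R Z n)"
        using t(2)[of n] by (intro y_optimal) auto
      then have "(t n)\<^sup>2 * e n - t n * inner v (X n) \<le> (t n)\<^sup>2 * (e' n - inner v \<xi>)"
        using g_eq[of n] g_eq'[of n] by linarith
      moreover have "t n * (inner v (X n) + t n * inner w (E n)) \<le> 0"
        using multiplier_le[OF w, of n] t(2)[of n] by (intro mult_nonneg_nonpos) auto
      ultimately have "(t n)\<^sup>2 * (e n + inner w (E n)) \<le> (t n)\<^sup>2 * (e' n - inner v \<xi>)"
        by (simp only: power2_eq_square distrib_left mult.assoc)
      then show "e n + inner w (E n) \<le> e' n - inner v \<xi>" using t(2)[of n] by simp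
    qed
    then have "q x0 + inner w (U x0) \<le> q x - inner v \<xi>"
      by (rule tendsto_le[OF sequentially_bot _ _, rotated 2]) (intro tendsto_intros e e' E)+
    \<comment> \<open>The near-optimality of \<xi> replaces \<open>- inner v \<xi>\<close> by
      \<open>\<sigma> (U x)\<close> up to \<delta>.\<close>
    then show "inner w (U x0) \<le> q x + \<sigma> (U x) - q x0 + \<delta>" using \<xi>(2) by simp
  qed
  then show "q x0 + \<sigma> (U x0) \<le> q x + \<sigma> (U x)" by simp
qed

section \<open>One-sided differentiability and the limit problem\<close>

text \<open>Bounded quotients whose cluster points all equal the unique minimiser converge along
  every positive null sequence. Existence of the minimiser also comes from a cluster point.\<close>

lemma derivative_characterization:
  obtains x0 where "(y has_vector_derivative x0) (at 0 within {0..})"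
    and "is_unique_arg_min (\<lambda>x. ereal (q x) + support_fun Y (U x)) K x0"
proof -
  have cluster: "\<exists>r x0. strict_mono (r :: nat \<Rightarrow> nat) \<and> (\<lambda>n. (1 / t (r n)) *\<^sub>R (y (t (r n)) - y 0)) \<longlonglongrightarrow> x0
      \<and> x0 \<in> K \<and> (\<forall>x\<in>K. q x0 + \<sigma> (U x0) \<le> q x + \<sigma> (U x))"
    if t: "t \<longlonglongrightarrow> 0" "\<And>n. t n > 0" for t
  proof -
    obtain x0 r where r: "strict_mono (r :: nat \<Rightarrow> nat)" "((\<lambda>n. (1 / t n) *\<^sub>R (y (t n) - y 0)) \<circ> r) \<longlonglongrightarrow> x0"
      using bounded_imp_convergent_subsequence[OF quotient_bounded[OF t]] by blast
    have "(t \<circ> r) \<longlonglongrightarrow> 0" "\<And>n. (t \<circ> r) n > 0" using t r by (auto intro: LIMSEQ_subseq_LIMSEQ)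
    from cluster_point_minimizer[OF this, of x0] r(2)
    have "x0 \<in> K" "\<forall>x\<in>K. q x0 + \<sigma> (U x0) \<le> q x + \<sigma> (U x)" by (auto simp: o_def)
    then show ?thesis using r by (auto simp: o_def)
  qed
  have "(\<lambda>n. 1 / real (Suc n)) \<longlonglongrightarrow> 0" by (rule LIMSEQ_Suc[OF lim_1_over_n])
  from cluster[OF this] obtain x0 where x0: "x0 \<in> K" "\<And>x. x \<in> K \<Longrightarrow> q x0 + \<sigma> (U x0) \<le> q x + \<sigma> (U x)"
    by auto
  have lim: "(\<lambda>n. (1 / t n) *\<^sub>R (y (t n) - y 0)) \<longlonglongrightarrow> x0" if t: "t \<longlonglongrightarrow> 0" "\<And>n. t n > 0" for t
  proof (rule ccontr)
    let ?X = "\<lambda>n. (1 / t n) *\<^sub>R (y (t n) - y 0)"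
    assume "\<not> ?X \<longlonglongrightarrow> x0"
    then obtain e where "e > 0" and "\<not> eventually (\<lambda>n. dist (?X n) x0 < e) sequentially"
      by (auto simp: tendsto_iff)
    then have "\<exists>\<^sub>F n in sequentially. e \<le> dist (?X n) x0"
      by (simp add: frequently_def not_le)
    then have "infinite {n. e \<le> dist (?X n) x0}"
      by (simp add: frequently_cofinite flip: cofinite_eq_sequentially)
    then obtain s :: "nat \<Rightarrow> nat" where s: "strict_mono s" "\<And>n. e \<le> dist (?X (s n)) x0"
      using infinite_enumerate[of "{n. e \<le> dist (?X n) x0}"] by auto
    \<comment> \<open>A subsequence staying at distance e from \<open>x0\<close> would again have a
      minimiser as cluster point.\<close>
    have "(t \<circ> s) \<longlonglongrightarrow> 0" using t(1) s(1) by (rule LIMSEQ_subseq_LIMSEQ)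
    then obtain r x1 where r: "strict_mono (r :: nat \<Rightarrow> nat)" "(\<lambda>n. ?X (s (r n))) \<longlonglongrightarrow> x1"
      and x1: "x1 \<in> K" "\<And>x. x \<in> K \<Longrightarrow> q x1 + \<sigma> (U x1) \<le> q x + \<sigma> (U x)"
      using cluster[of "t \<circ> s"] t(2) by auto
    have "x1 = x0" by (rule minimizer_unique[OF x1(1) x0(1) x1(2) x0(2)])
    with r(2) \<open>e > 0\<close> obtain n where "dist (?X (s (r n))) x0 < e"
      by (meson LIMSEQ_def order_refl)
    with s(2)[of "r n"] show False by simp
  qed
  have "(y has_vector_derivative x0) (at 0 within {0..})"
  proof -
    \<comment> \<open>Sequences in \<open>{0..}\<close> that avoid and tend to 0 are positive null
      sequences, so \<open>lim\<close> settles the one-sided limit.\<close>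
    have "((\<lambda>t. (1 / t) *\<^sub>R (y t - y 0)) \<longlongrightarrow> x0) (at 0 within {0..})"
      unfolding tendsto_at_iff_sequentially by (auto simp: o_def less_le intro!: lim)
    from LIM_zero[OF this]
    have "((\<lambda>t. (1 / norm (t - 0)) *\<^sub>R (y t - (y 0 + (t - 0) *\<^sub>R x0))) \<longlongrightarrow> 0) (at 0 within {0..})"
      by (rule Lim_transform_eventually)
        (auto simp: eventually_at_filter scaleR_diff_right scaleR_add_right)
    then show ?thesis
      by (simp only: has_vector_derivative_def has_derivative_within bounded_linear_scaleR_left simp_thms)
  qed
  moreover have "is_unique_arg_min (\<lambda>x. ereal (q x) + support_fun Y (U x)) K x0"
    unfolding is_unique_arg_min_def is_arg_min_iff support_fun_real plus_ereal.simps ereal_less_eq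
    using x0 minimizer_unique by blast
  ultimately show thesis by (rule that)
qed

end

section \<open>Identification of the given derivatives with the data of the program\<close>

theorem proposition47:
  fixes F :: "real \<Rightarrow> real ^ 'm \<Rightarrow> real ^ 'd"
    and g :: "real \<Rightarrow> real ^ 'm \<Rightarrow> real"
  assumes "\<And>i. (\<lambda>t x. ereal (F t x $ i)) \<in> Gamma0"
    and "\<And>t. t \<ge> 0 \<Longrightarrow> feasible_set F t \<noteq> {}"
    and "\<And>t x. t \<ge> 0 \<Longrightarrow> g t differentiable (at x)"
    and "\<And>t. t \<ge> 0 \<Longrightarrow> grad (g t) \<in> A_maps"
  shows "(\<forall>t\<ge>0. \<exists>!x. is_arg_min (g t) (\<lambda>x. x \<in> feasible_set F t) x) \<and>
    (\<forall>y :: real \<Rightarrow> real ^ 'm.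
       (\<forall>t\<ge>0. is_arg_min (g t) (\<lambda>x. x \<in> feasible_set F t) (y t)) \<longrightarrow>
       (\<lambda>t x. grad (g t) x) \<in> A_unif \<longrightarrow>
       C1_on half_space (\<lambda>(t, x). grad (g t) x) \<longrightarrow>
       C2_on half_space (\<lambda>(t, x). F t x) \<longrightarrow>
       vector_derivative (\<lambda>t. F t (y 0)) (at 0 within {0..}) = 0 \<longrightarrow>
       (\<forall>t\<ge>0. y 0 \<in> feasible_set F t) \<longrightarrow>
       (\<exists>\<alpha>>0. \<forall>t\<ge>0. \<forall>w \<in> normal_cone nonpos_orthant (F t (y 0)). norm w = 1 \<longrightarrow>
          norm (transpose (jacobian (F t) (at (y 0))) *v w) \<ge> \<alpha>) \<longrightarrow>
       y differentiable (at 0 within {0..}) \<and>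
       is_unique_arg_min
         (limit_objective F g (y 0) (- grad (g 0) (y 0)))
         (K_set F (y 0) (- grad (g 0) (y 0)))
         (vector_derivative y (at 0 within {0..})))"
proof (intro conjI allI impI)
  fix t :: real assume t: "t \<ge> 0"
  obtain \<alpha> where \<alpha>: "\<alpha> > 0" "strongly_monotone_with \<alpha> (grad (g t))"
    using assms(4)[OF t] by (auto simp: A_maps_def)
  show "\<exists>!x. is_arg_min (g t) (\<lambda>x. x \<in> feasible_set F t) x"
    using assms(2)[OF t] \<alpha> convex_on_if_Gamma0[OF assms(1) t]
    by (intro strongly_convex_unique_arg_min[where G = "grad (g t)" and \<alpha> = \<alpha>] GDERIV_grad assms(3)[OF t]
        feasible_set_convex_closed) auto
next
  fix y :: "real \<Rightarrow> real ^ 'm"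
  let ?F = "\<lambda>(t, x). F t x" and ?G = "\<lambda>(t, x). grad (g t) x"
  let ?DF = "Fderiv half_space ?F"
  assume min: "\<forall>t\<ge>0. is_arg_min (g t) (\<lambda>x. x \<in> feasible_set F t) (y t)"
    and unif: "(\<lambda>t x. grad (g t) x) \<in> A_unif"
    and C1: "C1_on half_space ?G" and C2: "C2_on half_space ?F"
    and time: "vector_derivative (\<lambda>t. F t (y 0)) (at 0 within {0..}) = 0"
    and feas: "\<forall>t\<ge>0. y 0 \<in> feasible_set F t"
    and cq: "\<exists>\<alpha>>0. \<forall>t\<ge>0. \<forall>w \<in> normal_cone nonpos_orthant (F t (y 0)). norm w = 1 \<longrightarrow>
          norm (transpose (jacobian (F t) (at (y 0))) *v w) \<ge> \<alpha>"
  obtain \<alpha> where \<alpha>: "\<alpha> > 0" "\<And>t. t \<ge> 0 \<Longrightarrow> strongly_monotone_with \<alpha> (grad (g t))"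
    using unif by (auto simp: A_unif_def)
  obtain c where c: "c > 0" "\<And>w. w \<in> normal_cone nonpos_orthant (F 0 (y 0)) \<Longrightarrow> norm w = 1 \<Longrightarrow>
      norm (transpose (jacobian (F 0) (at (y 0))) *v w) \<ge> c"
    using cq by (meson order_refl)
  have DF: "(?F has_derivative ?DF z) (at z within half_space)" if "z \<in> half_space" for z
    using C2 that unfolding C2_on_def C1_on_def differentiable_on_def by (intro has_derivative_Fderiv) blast
  have D2F: "(?DF has_derivative Fderiv half_space ?DF (0, y 0)) (at (0, y 0) within half_space)"
    using C2 unfolding C2_on_def C1_on_def differentiable_on_def by (intro has_derivative_Fderiv) blast
  have DG: "(?G has_derivative Fderiv half_space ?G (0, y 0)) (at (0, y 0) within half_space)"
    using C1 unfolding C1_on_def differentiable_on_def by (intro has_derivative_Fderiv) blast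
  define b where "b = vector_derivative (\<lambda>t. grad (g t) (y 0)) (at 0 within {0..})"
  define H where "H = frechet_derivative (grad (g 0)) (at (y 0))"
  have b: "Fderiv half_space ?G (0, y 0) (1, 0) = b"
    using vector_derivative_partial_time[OF DG] by (simp add: b_def)
  have H: "Fderiv half_space ?G (0, y 0) (0, h) = H h" for h
    using frechet_derivative_at[OF has_derivative_partial_space[OF DG]] by (simp add: H_def fun_eq_iff)
  \<comment> \<open>By linearity the joint derivative of the gradient splits into its right time
    derivative and its spatial derivative.\<close>
  have "blinfun_apply (Fderiv half_space ?G (0, y 0)) = (\<lambda>(\<tau>, h). \<tau> *\<^sub>R b + H h)"
  proof (rule ext, clarify)
    fix \<tau> :: real and h :: "real ^ 'm"
    have "Fderiv half_space ?G (0, y 0) (\<tau>, h)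
        = Fderiv half_space ?G (0, y 0) (\<tau> *\<^sub>R (1, 0) + (0, h))" by simp
    also have "\<dots> = \<tau> *\<^sub>R b + H h"
      by (simp only: blinfun.add_right blinfun.scaleR_right b H)
    finally show "Fderiv half_space ?G (0, y 0) (\<tau>, h) = \<tau> *\<^sub>R b + H h" .
  qed
  with DG have DG': "(?G has_derivative (\<lambda>(\<tau>, h). \<tau> *\<^sub>R b + H h)) (at (0, y 0) within half_space)"
    by simp
  have grad: "GDERIV (g t) x :> grad (g t) x" if "t \<ge> 0" for t x
    using assms(3)[OF that] by (rule GDERIV_grad)
  interpret perturbed_program F ?DF "Fderiv half_space ?DF (0, y 0)" g "\<lambda>t. grad (g t)" b H \<alpha> c y
  proof
    \<comment> \<open>The right time derivative at \<open>y 0\<close> is the joint derivative in the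
      direction \<open>(1, 0)\<close>.\<close>
    show "?DF (0, y 0) (1, 0) = 0"
      using vector_derivative_partial_time[OF DF, of "y 0"] time by simp
  qed (use convex_on_if_Gamma0[OF assms(1)] DF D2F DG' grad \<alpha> c min feas in auto)
  obtain x0 where x0: "(y has_vector_derivative x0) (at 0 within {0..})"
    "is_unique_arg_min (\<lambda>x. ereal (q x) + support_fun Y (U x)) K x0"
    by (rule derivative_characterization)
  show "y differentiable (at 0 within {0..})" using x0(1) by (rule differentiableI_vector)
  have "limit_objective F g (y 0) (- grad (g 0) (y 0)) = (\<lambda>x. ereal (q x) + support_fun Y (U x))"
    by (rule ext) (simp only: limit_objective_def q_def U_def D2_quad_def b_def[symmetric] H_def[symmetric])
  then show "is_unique_arg_min (limit_objective F g (y 0) (- grad (g 0) (y 0)))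
      (K_set F (y 0) (- grad (g 0) (y 0))) (vector_derivative y (at 0 within {0..}))"
    using x0(2) vector_derivative_right_eq[OF x0(1)] by simp
qed

end
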